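(* Let $A,B\in O(d)$, let $I\subseteq\{1,\dots,d\}$ with $|I|=m$, where $1\le m\le d$, let $X\subseteq\mathbb S^{d-1}$ with $|X|=N$, and let $0<\eta<1/2$. Set $$\ell=\log\left(\frac{8N}{\eta}\right),\qquad L_d=\log\left(\frac{8Nd}{\eta}\right),\qquad L_m=\log\left(\frac{8Nm}{\eta}\right).$$ Suppose that $$36\,\kappa_I(A)\,\Theta_B(X)\,m\,L_d\,L_m\le d.$$ Then the random linear map $\Phi=\sqrt{\frac dm}\,P_IAD_\xi P_\pi BD_{\xi'}$ satisfies, with probability at least $1-\eta$, $$\sup_{x\in X}\bigl|\|\Phi x\|_2-1\bigr|\le10\sqrt{\frac{\ell}{m}}.$$
   Context: $O(d)$ is the group of real orthogonal $d\times d$ matrices, $\mathbb S^{d-1}$ the Euclidean unit sphere of $\mathbb R^d$, $[d]=\{1,\dots,d\}$. $P_I\in\mathbb R^{m\times d}$ is restriction to the coordinates in $I$. $\xi,\xi'$ are uniform on $\{-1,1\}^d$, $\pi$ is a uniform permutation in $S_d$, and $\xi,\xi',\pi$ are independent; $D_\xi=\operatorname{diag}(\xi_1,\dots,\xi_d)$, and $P_\pi$ is the permutation matrix with $(P_\pi x)_k=x_{\pi(k)}$. The sampled column energy of $A$ is $\kappa_I(A)=\frac dm\max_{k\in[d]}\sum_{j\in I}A_{jk}^2$, and the maximal variance of $B$ on $X$ is $\Theta_B(X)=d\sup_{x\in X,\,k\in[d]}\sum_{j=1}^dB_{kj}^2x_j^2$. *)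

theory Defs
  imports "HOL-Analysis.Analysis" "HOL-Probability.Probability"
begin

definition sign_vectors :: "(real ^ 'd::finite) set" where
  "sign_vectors = {\<xi>. \<forall>i. \<xi> $ i \<in> {-1, 1}}"

definition diag_matrix :: "real ^ 'd \<Rightarrow> real ^ 'd::finite ^ 'd" where
  "diag_matrix v = (\<chi> i j. if i = j then v $ i else 0)"

text \<open>For a function \<open>f\<close> on indices, the matrix of the map \<open>x \<mapsto> (x\<^bsub>f(k)\<^esub>)\<^sub>k\<close>. For a permutation
  \<open>\<pi>\<close> it is \<open>P\<^sub>\<pi>\<close>; for a bijection \<open>e\<close> from the row indices onto \<open>I\<close> it is the coordinate
  restriction \<open>P\<^sub>I\<close>, with the coordinates in \<open>I\<close> listed in the order given by \<open>e\<close>.\<close>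

definition reindex_matrix :: "('m \<Rightarrow> 'd) \<Rightarrow> real ^ 'd::finite ^ 'm::finite" where
  "reindex_matrix f = (\<chi> k j. if j = f k then 1 else 0)"

lemma reindex_matrix_mult_vec: "(reindex_matrix f *v x) $ k = x $ f k"
  by (simp add: reindex_matrix_def matrix_vector_mult_def if_distrib [of "\<lambda>c. c * _"] cong: if_cong)

definition column_energy :: "'d set \<Rightarrow> real ^ 'd ^ 'd::finite \<Rightarrow> real" where
  "column_energy I A = real CARD('d) / real (card I) * (MAX k. \<Sum>j\<in>I. (A $ j $ k)\<^sup>2)"

definition max_variance :: "real ^ 'd ^ 'd \<Rightarrow> (real ^ 'd::finite) set \<Rightarrow> real" where
  "max_variance B X =
     real CARD('d) * (SUP (x, k) \<in> X \<times> UNIV. \<Sum>j\<in>UNIV. (B $ k $ j)\<^sup>2 * (x $ j)\<^sup>2)"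

definition random_source :: "((real ^ 'd::finite) \<times> (real ^ 'd) \<times> ('d \<Rightarrow> 'd)) pmf" where
  "random_source = pair_pmf (pmf_of_set sign_vectors)
     (pair_pmf (pmf_of_set sign_vectors) (pmf_of_set {\<pi>. \<pi> permutes UNIV}))"

definition random_map ::
  "('m \<Rightarrow> 'd) \<Rightarrow> real ^ 'd ^ 'd \<Rightarrow> real ^ 'd ^ 'd \<Rightarrow> real ^ 'd \<Rightarrow> real ^ 'd \<Rightarrow> ('d \<Rightarrow> 'd)
    \<Rightarrow> real ^ 'd::finite ^ 'm::finite" where
  "random_map e A B \<xi> \<xi>' \<pi> = sqrt (real CARD('d) / real CARD('m)) *\<^sub>R
     (reindex_matrix e ** A ** diag_matrix \<xi> ** reindex_matrix \<pi> ** B ** diag_matrix \<xi>')"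

text \<open>\<^const>\<open>pmf_of_set\<close> is the uniform distribution only on finite nonempty sets.\<close>

lemma sign_vectors_finite_nonempty:
  "finite (sign_vectors :: (real ^ 'd::finite) set)" "(sign_vectors :: (real ^ 'd::finite) set) \<noteq> {}"
proof -
  have "sign_vectors \<subseteq> vec_lambda ` (UNIV \<rightarrow>\<^sub>E {-1, 1 :: real} :: ('d \<Rightarrow> real) set)"
  proof
    fix \<xi> :: "real ^ 'd"
    assume "\<xi> \<in> sign_vectors"
    then have "vec_nth \<xi> \<in> UNIV \<rightarrow>\<^sub>E {-1, 1}"
      by (auto simp: sign_vectors_def)
    then show "\<xi> \<in> vec_lambda ` (UNIV \<rightarrow>\<^sub>E {-1, 1})"
      by (metis image_eqI vec_nth_inverse)
  qed
  then show "finite (sign_vectors :: (real ^ 'd) set)"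
    by (rule finite_subset) (intro finite_imageI finite_PiE, auto)
  have "(\<chi> i. 1) \<in> (sign_vectors :: (real ^ 'd) set)"
    by (simp add: sign_vectors_def)
  then show "(sign_vectors :: (real ^ 'd) set) \<noteq> {}"
    by blast
qed

lemma permutations_finite_nonempty:
  "finite {\<pi> :: 'd::finite \<Rightarrow> 'd. \<pi> permutes UNIV}" "{\<pi> :: 'd::finite \<Rightarrow> 'd. \<pi> permutes UNIV} \<noteq> {}"
  by (auto simp: finite_permutations intro: permutes_id exI [of _ id])

end

theory Submission
  imports Defs
begin

text \<open>Fix \<open>x\<close> and put \<open>y = B D\<^bsub>\<xi>'\<^esub> x\<close>, so that \<open>\<Phi>x = \<Sum>\<^sub>k \<xi>\<^sub>k b\<^sub>k\<close>, where \<open>b\<^sub>k = y\<^bsub>\<pi>(k)\<^esub> h\<^sub>k\<close> and \<open>h\<^sub>k\<close> is the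
  \<open>k\<close>-th column of \<open>(d/m)\<^bsup>1/2\<^esup> P\<^sub>I A\<close>. Three sources of randomness are used one after the other.

  Hoeffding's inequality makes \<open>y\<close> flat: \<open>y\<^sub>k\<^sup>2 \<le> 2 \<Theta> L\<^sub>d / d\<close> for all \<open>k\<close>.

  For a flat \<open>y\<close>, the random permutation makes \<open>S = \<Sum>\<^sub>k b\<^sub>k b\<^sub>k\<^sup>T\<close> well conditioned: its largest
  eigenvalue is below \<open>2/m\<close> and its trace is within \<open>1/(2 m\<^bsup>1/2\<^esup>)\<close> of \<open>1\<close>. A convex function of such a
  permuted sum is dominated in mean by the same function of a sum with independent indices. For the
  matrix bound the function is a truncation of \<open>tr exp(\<theta> S)\<close>. The summands have rank one, and this
  allows a proof of the matrix Chernoff bound with powers only, free of the spectral theorem and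
  of matrix exponentials.

  Given such an \<open>S\<close>, the chaos \<open>\<parallel>\<Sum>\<^sub>k \<xi>\<^sub>k b\<^sub>k\<parallel>\<^sup>2\<close> is concentrated around the trace of \<open>S\<close>. Its exponential
  moment is bounded by eliminating the signs one at a time.\<close>

section \<open>Positive semidefinite matrices and traces of powers\<close>

text \<open>Permuted indices are dependent, so an exponential moment of S cannot be peeled off one
  index at a time. After the passage to independent indices each peeling step averages over one
  isotropic family of columns.

  The matrix S has size m, so its tail costs a factor m; flatness costs a union bound over d
  coordinates. This is the origin of the two logarithms \<open>L_m\<close> and \<open>L_d\<close>.
  Trace and chaos are scalar and need only l.

  The constant 36 is 2 times 18. The 2 comes from the subgaussian bound on the squares of y, and 18
  keeps every y_j^2 |h_k|^2 below R = 1/(18 m L_m). The matrix bound with \<theta> = 3 m L_m then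
  has \<theta> R = 1/6 and an exponent below -L_m; the trace bound keeps the exponent -(18/16) l.

  Each logarithm absorbs its own dimension factor, so every failure term is a multiple of
  \<eta>/(8N): two for flatness, one for the matrix, two for the trace, two for the chaos. Seven of
  the eight shares are spent.\<close>

lemma logconvex_sequence_mult_le:
  fixes \<mu> :: "nat \<Rightarrow> real"
  assumes nonneg: "\<And>i. 0 \<le> \<mu> i" and lc: "\<And>i. (\<mu> (Suc i))\<^sup>2 \<le> \<mu> i * \<mu> (Suc (Suc i))"
  shows "\<mu> i * \<mu> j \<le> \<mu> 0 * \<mu> (i + j)"
proof (cases "\<mu> 1 = 0")
  case True
  have z: "\<mu> (Suc i) = 0" for i
  proof (induction i)
    case (Suc i)
    then show ?case using lc [of "Suc i"] by simp
  qed (use True in simp)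
  show ?thesis
    by (cases i; cases j) (auto simp: z)
next
  case False
  then have p1: "0 < \<mu> 1" using nonneg [of 1] by simp
  have p0: "0 < \<mu> 0"
    using lc [of 0] p1 nonneg [of 0] by (cases "\<mu> 0 = 0") auto
  have pos: "0 < \<mu> i \<and> 0 < \<mu> (Suc i)" for i
  proof (induction i)
    case (Suc i)
    then have "0 < (\<mu> (Suc i))\<^sup>2" by simp
    with lc [of i] Suc have "0 < \<mu> (Suc (Suc i))"
      by (metis less_le_trans zero_less_mult_pos)
    with Suc show ?case by simp
  qed (use p0 p1 in simp)
  \<comment> \<open>Past the case where \<open>\<mu> 1\<close> vanishes, which kills all later
    terms, the sequence is positive and log-convexity says that these ratios increase. Moving one
    step from index i to the larger index i + j can then only enlarge the product.\<close>
  define r where "r i = \<mu> (Suc i) / \<mu> i" for i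
  have rm: "r i \<le> r (Suc i)" for i
    using lc [of i] pos [of i] by (simp add: r_def divide_simps power2_eq_square mult.commute)
  have rmono: "r i \<le> r (i + j)" for i j
    by (induction j) (use rm order_trans in auto)
  have step: "\<mu> (Suc i) = r i * \<mu> i" for i
    using pos [of i] by (simp add: r_def)
  show ?thesis
  proof (induction i)
    case (Suc i)
    have rp: "0 \<le> r i" using pos [of i] by (simp add: r_def)
    have "\<mu> (Suc i) * \<mu> j = r i * (\<mu> i * \<mu> j)" by (simp add: step)
    also have "\<dots> \<le> r i * (\<mu> 0 * \<mu> (i + j))" using Suc rp by (rule mult_left_mono)
    also have "\<dots> \<le> r (i + j) * (\<mu> 0 * \<mu> (i + j))"
      using rmono nonneg by (intro mult_right_mono) auto
    finally show ?case by (simp add: step mult_ac)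
  qed simp
qed

text \<open>The left side is a sum of n increments, and by convexity the last one is the largest.
  For n = 0 the truncated \<open>n - 1\<close> is 0 and both sides vanish.\<close>

lemma convex_seq_backward_diff:
  fixes T :: "nat \<Rightarrow> real"
  assumes "\<And>i. Suc (Suc i) \<le> n \<Longrightarrow> 0 \<le> T (Suc (Suc i)) - 2 * T (Suc i) + T i"
  shows "T n - T 0 \<le> real n * (T n - T (n - 1))"
  using assms
proof (induction n)
  case (Suc n)
  show ?case
  proof (cases n)
    case 0 then show ?thesis by simp
  next
    case (Suc k)
    have "T n - T 0 \<le> real n * (T n - T (n - 1))"
      using Suc.IH Suc.prems by simp
    also have "\<dots> \<le> real n * (T (Suc n) - T n)"
      using Suc.prems [of k] Suc by (intro mult_left_mono) auto
    finally show ?thesis by (simp add: algebra_simps)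
  qed
qed simp

section \<open>The cone generated by rank-one matrices, and its traces\<close>

definition outer :: "real ^ 'n \<Rightarrow> real ^ 'n ^ 'n" where
  "outer v = (\<chi> i j. v $ i * v $ j)"

primrec mpow :: "real ^ 'n ^ 'n \<Rightarrow> nat \<Rightarrow> real ^ 'n ^ 'n" where
  "mpow A 0 = mat 1"
| "mpow A (Suc n) = A ** mpow A n"

text \<open>Generated as finite sums of v v^T rather than by the sign of the quadratic form:
  symmetry is built in, and closure under conjugation and the trace inequalities follow by induction
  on the sum, without square roots or diagonalization.\<close>

inductive psd :: "real ^ 'n ^ 'n \<Rightarrow> bool" where
  psd_zero: "psd 0"
| psd_add_outer: "psd A \<Longrightarrow> psd (A + outer v)"

lemma matrix_add_rdistrib: "(A + B) ** C = A ** C + B ** (C :: real ^ 'n ^ 'm)"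
  by (vector matrix_matrix_mult_def sum.distrib [symmetric] field_simps)

lemma matrix_diff_rdistrib: "(A - B) ** C = A ** C - B ** (C :: real ^ 'n ^ 'm)"
  by (vector matrix_matrix_mult_def sum_subtractf [symmetric] field_simps)

lemma matrix_diff_ldistrib: "A ** (B - C) = A ** B - A ** (C :: real ^ 'n ^ 'm)"
  by (vector matrix_matrix_mult_def sum_subtractf [symmetric] field_simps)

lemma matrix_scaleR_left: "(c *\<^sub>R A) ** B = c *\<^sub>R (A ** (B :: real ^ 'n ^ 'm))"
  by (vector matrix_matrix_mult_def sum_distrib_left mult_ac)

lemma matrix_scaleR_right: "A ** (c *\<^sub>R B) = c *\<^sub>R (A ** (B :: real ^ 'n ^ 'm))"
  by (vector matrix_matrix_mult_def sum_distrib_left mult_ac)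

lemma matrix_zero_left: "0 ** B = (0 :: real ^ 'n ^ 'k)"
  by (vector matrix_matrix_mult_def)

lemma matrix_zero_right: "B ** 0 = (0 :: real ^ 'n ^ 'k)"
  by (vector matrix_matrix_mult_def)

lemma matrix_scaleR_vector: "(c *\<^sub>R A) *v x = c *\<^sub>R (A *v (x :: real ^ 'n))"
  by (vector matrix_vector_mult_def sum_distrib_left mult_ac)

lemma matrix_vector_scaleR: "A *v (c *\<^sub>R x) = c *\<^sub>R (A *v (x :: real ^ 'n))"
  by (simp add: linear_scale [OF matrix_vector_mul_linear])

lemma trace_scaleR: "trace (c *\<^sub>R A) = c * trace (A :: real ^ 'n ^ 'n)"
  by (simp add: trace_def sum_distrib_left)

lemma trace_zero: "trace (0 :: real ^ 'n ^ 'n) = 0"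
  by (simp add: trace_def)

lemma outer_mult_vec: "outer v *v x = (v \<bullet> x) *\<^sub>R v"
  by (simp add: vec_eq_iff outer_def matrix_vector_mult_def inner_vec_def sum_distrib_right
      sum_distrib_left mult_ac)

lemma trace_outer_mult: "trace (A ** outer v) = v \<bullet> (A *v v)"
  by (simp add: trace_def outer_def matrix_matrix_mult_def matrix_vector_mult_def inner_vec_def
      sum_distrib_left mult_ac)

lemma trace_outer: "trace (outer v) = v \<bullet> v"
  by (simp add: trace_def outer_def inner_vec_def)

lemma transpose_outer: "transpose (outer v) = outer v"
  by (vector transpose_def outer_def mult.commute)

lemma transpose_add: "transpose (A + B) = transpose A + transpose (B :: real ^ 'n ^ 'm)"
  by (vector transpose_def)

lemma outer_conj: "P ** outer v ** transpose P = outer (P *v v)"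
proof -
  have "(P ** outer v ** transpose P) *v x = outer (P *v v) *v x" for x
  proof -
    have "v \<bullet> (transpose P *v x) = (P *v v) \<bullet> x"
      by (metis dot_lmul_matrix inner_commute transpose_matrix_vector)
    then show ?thesis
      by (simp add: matrix_vector_mul_assoc [symmetric] outer_mult_vec matrix_vector_scaleR)
  qed
  then show ?thesis by (simp add: matrix_eq)
qed

lemma outer_scaleR: "outer (c *\<^sub>R v) = c\<^sup>2 *\<^sub>R outer v"
  by (vector outer_def power2_eq_square mult_ac)

lemma psd_outer: "psd (outer v)"
  using psd_add_outer [OF psd_zero, of v] by simp

lemma psd_add:
  assumes "psd A" "psd B"
  shows "psd (A + B)"
  using assms(2) by (induction B rule: psd.induct)
    (auto simp: add.assoc [symmetric] assms(1) intro: psd_add_outer)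

lemma psd_sum: "(\<And>i. i \<in> S \<Longrightarrow> psd (f i)) \<Longrightarrow> psd (\<Sum>i\<in>S. f i)"
  by (induction S rule: infinite_finite_induct) (auto intro: psd_zero psd_add)

lemma psd_scaleR: "psd A \<Longrightarrow> 0 \<le> c \<Longrightarrow> psd (c *\<^sub>R A)"
proof (induction A rule: psd.induct)
  case (psd_add_outer A v)
  then have "psd (c *\<^sub>R A + outer (sqrt c *\<^sub>R v))" by (intro psd.psd_add_outer) auto
  then show ?case using psd_add_outer by (simp add: outer_scaleR scaleR_add_right)
qed (auto intro: psd_zero)

lemma psd_mat1: "psd (mat 1)"
proof -
  have "mat 1 = (\<Sum>i\<in>UNIV. outer (axis i 1 :: real ^ 'n))"
    by (simp add: vec_eq_iff outer_def mat_def axis_def if_distrib [of "\<lambda>x. x * _"] cong: if_cong)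
  then show ?thesis by (metis psd_sum psd_outer)
qed

lemma psd_conj: "psd A \<Longrightarrow> psd (P ** A ** transpose P)"
  by (induction A rule: psd.induct)
    (auto simp: matrix_zero_left matrix_zero_right matrix_add_ldistrib matrix_add_rdistrib outer_conj
      intro: psd.intros)

lemma psd_transpose: "psd A \<Longrightarrow> transpose A = A"
  by (induction A rule: psd.induct)
    (simp_all add: transpose_add transpose_outer, simp add: transpose_def vec_eq_iff)

lemma psd_quad: "psd A \<Longrightarrow> 0 \<le> x \<bullet> (A *v x)"
  by (induction A rule: psd.induct)
    (auto simp: matrix_vector_mult_add_rdistrib outer_mult_vec inner_add_right inner_commute)

lemma psd_inner: "psd A \<Longrightarrow> (A *v x) \<bullet> y = x \<bullet> (A *v y)"
  by (metis dot_lmul_matrix psd_transpose vector_transpose_matrix)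

text \<open>The trace dominates the largest eigenvalue: for each rank-one term this is
  Cauchy-Schwarz.\<close>

lemma psd_quad_le_trace: "psd A \<Longrightarrow> norm x = 1 \<Longrightarrow> x \<bullet> (A *v x) \<le> trace A"
proof (induction A rule: psd.induct)
  case (psd_add_outer A v)
  have "(v \<bullet> x)\<^sup>2 \<le> (v \<bullet> v) * (x \<bullet> x)" by (rule Cauchy_Schwarz_ineq)
  then show ?case using psd_add_outer
    by (auto simp: matrix_vector_mult_add_rdistrib outer_mult_vec inner_add_right trace_add
        trace_outer inner_commute power2_eq_square dot_square_norm)
qed (simp add: trace_zero)

text \<open>A product of two such matrices need not be symmetric, but each rank-one term v v^T of B
  contributes the nonnegative number v \<bullet> A v to the trace.\<close>

lemma trace_psd_psd:
  assumes "psd A" "psd B"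
  shows "0 \<le> trace (A ** B)"
  using assms(2) by (induction B rule: psd.induct)
    (auto simp: matrix_zero_right trace_zero matrix_add_ldistrib trace_add trace_outer_mult psd_quad assms(1))

lemma trace_psd: "psd A \<Longrightarrow> 0 \<le> trace A"
  using trace_psd_psd [OF _ psd_mat1] by fastforce

section \<open>Powers, moments and convexity of their traces\<close>

lemma mpow_commute: "A ** mpow A n = mpow A n ** A"
  by (induction n) (auto simp: matrix_mul_assoc)

lemma mpow_commute_left: "A ** (mpow A n ** B) = mpow A n ** (A ** B)"
  by (simp add: matrix_mul_assoc mpow_commute)

lemmas mpow_ac = mpow_commute mpow_commute_left matrix_mul_assoc [symmetric]

text \<open>The induction descends by two, because A^(k+2) is the conjugate of A^k by the symmetric
  matrix A.\<close>

lemma psd_mpow: "psd A \<Longrightarrow> psd (mpow A n)"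
proof (induction n rule: less_induct)
  case (less n)
  consider "n = 0" | "n = 1" | k where "n = Suc (Suc k)"
    by (metis One_nat_def not0_implies_Suc)
  then show ?case
  proof cases
    case 3
    have "psd (A ** mpow A k ** transpose A)" using less 3 by (intro psd_conj) auto
    also have "A ** mpow A k ** transpose A = mpow A n"
      using less 3 by (simp add: psd_transpose mpow_ac)
    finally show ?thesis .
  qed (use less in \<open>auto intro: psd_mat1\<close>)
qed

lemma psd_quad_Cauchy_Schwarz:
  assumes "psd A"
  shows "(x \<bullet> (A *v y))\<^sup>2 \<le> (x \<bullet> (A *v x)) * (y \<bullet> (A *v y))"
proof -
  define a b c where "a = x \<bullet> (A *v x)" and "b = x \<bullet> (A *v y)" and "c = y \<bullet> (A *v y)"
  have sym: "y \<bullet> (A *v x) = b"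
    by (metis assms b_def inner_commute psd_inner)
  have q: "0 \<le> s\<^sup>2 * a + 2 * s * t * b + t\<^sup>2 * c" for s t
    using psd_quad [OF assms, of "s *\<^sub>R x + t *\<^sub>R y"]
    by (simp add: matrix_vector_right_distrib matrix_vector_scaleR inner_add_left inner_add_right
        sym a_def [symmetric] b_def [symmetric] c_def [symmetric] power2_eq_square algebra_simps)
  have a: "0 \<le> a" and c: "0 \<le> c" using psd_quad [OF assms] by (auto simp: a_def c_def)
  have "b\<^sup>2 \<le> a * c"
  proof (cases "a = 0 \<and> c = 0")
    case True
    then show ?thesis using q [of 1 1] q [of 1 "-1"] by auto
  next
    case False
    \<comment> \<open>The test points (-b, a) and (c, -b) produce the discriminant multiplied by a
      and by c, at least one of which is positive here.\<close>
    have "0 \<le> a * (a * c - b\<^sup>2)"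
      using q [of "- b" a] by (simp add: power2_eq_square algebra_simps)
    moreover have "0 \<le> c * (a * c - b\<^sup>2)"
      using q [of c "- b"] by (simp add: power2_eq_square algebra_simps)
    ultimately show ?thesis
      using False a c by (auto simp: zero_le_mult_iff)
  qed
  then show ?thesis by (simp add: a_def b_def c_def)
qed

text \<open>These numbers are the moments of the spectral measure of v. Their log-convexity is
  Cauchy-Schwarz for the form of C^i, applied to v and C v; the product inequality is then a
  statement about scalar sequences.\<close>

lemma psd_moments_mult_le:
  assumes "psd C"
  shows "(v \<bullet> (mpow C i *v v)) * (v \<bullet> (mpow C j *v v)) \<le> (v \<bullet> v) * (v \<bullet> (mpow C (i + j) *v v))"
proof -
  define \<mu> where "\<mu> i = v \<bullet> (mpow C i *v v)" for i
  have "\<mu> i * \<mu> j \<le> \<mu> 0 * \<mu> (i + j)"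
  proof (rule logconvex_sequence_mult_le)
    show "0 \<le> \<mu> i" for i by (simp add: \<mu>_def psd_quad psd_mpow assms)
    show "(\<mu> (Suc i))\<^sup>2 \<le> \<mu> i * \<mu> (Suc (Suc i))" for i
    proof -
      have "v \<bullet> (mpow C i *v (C *v v)) = \<mu> (Suc i)"
        by (simp add: \<mu>_def matrix_vector_mul_assoc mpow_commute)
      moreover have "(C *v v) \<bullet> (mpow C i *v (C *v v)) = \<mu> (Suc (Suc i))"
        by (simp add: \<mu>_def psd_inner [OF assms] matrix_vector_mul_assoc mpow_ac)
      ultimately show ?thesis
        using psd_quad_Cauchy_Schwarz [OF psd_mpow [OF assms], of v i "C *v v"]
        by (simp add: \<mu>_def)
    qed
  qed
  then show ?thesis by (simp add: \<mu>_def)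
qed

text \<open>Jensen's inequality for the spectral measure of x, obtained by applying the moment
  inequality with i = 1 repeatedly. It turns a large value of the quadratic form into a large trace
  of every power, as Markov's inequality requires.\<close>

lemma psd_quad_power_le_trace:
  assumes "psd C" and "norm x = 1"
  shows "(x \<bullet> (C *v x)) ^ p \<le> trace (mpow C p)"
proof -
  have one: "x \<bullet> x = 1" using assms by (simp add: dot_square_norm)
  have "(x \<bullet> (C *v x)) ^ p \<le> x \<bullet> (mpow C p *v x)"
  proof (induction p)
    case (Suc p)
    have "(x \<bullet> (C *v x)) ^ Suc p \<le> (x \<bullet> (C *v x)) * (x \<bullet> (mpow C p *v x))"
      using Suc psd_quad [OF assms(1), of x] by (simp add: mult_left_mono)
    also have "\<dots> \<le> x \<bullet> (mpow C (Suc p) *v x)"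
      using psd_moments_mult_le [OF assms(1), of x 1 p] one by simp
    finally show ?case .
  qed (simp add: one)
  also have "\<dots> \<le> trace (mpow C p)"
    by (intro psd_quad_le_trace psd_mpow assms)
  finally show ?thesis .
qed

text \<open>The second difference equals tr((S - P) S^a (S - P) P^b), the trace of a product of two
  psd matrices; cyclicity of the trace merges the two mixed terms.\<close>

lemma trace_mixed_powers_convex:
  assumes "psd S" "psd P"
  shows "0 \<le> trace (mpow S (Suc (Suc a)) ** mpow P b) - 2 * trace (mpow S (Suc a) ** mpow P (Suc b))
    + trace (mpow S a ** mpow P (Suc (Suc b)))"
proof -
  have sym: "transpose (S - P) = S - P"
    using psd_transpose [OF assms(1)] psd_transpose [OF assms(2)]
    by (simp add: vec_eq_iff transpose_def)
  have "0 \<le> trace (((S - P) ** mpow S a ** transpose (S - P)) ** mpow P b)"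
    by (intro trace_psd_psd psd_conj psd_mpow assms)
  also have "\<dots> = trace (S ** mpow S a ** S ** mpow P b) - trace (S ** mpow S a ** P ** mpow P b)
     - trace (P ** mpow S a ** S ** mpow P b) + trace (P ** mpow S a ** P ** mpow P b)"
    unfolding sym
    by (simp add: matrix_diff_ldistrib matrix_diff_rdistrib trace_sub matrix_mul_assoc)
  also have "S ** mpow S a ** S ** mpow P b = mpow S (Suc (Suc a)) ** mpow P b"
    by (simp add: mpow_ac)
  also have "S ** mpow S a ** P ** mpow P b = mpow S (Suc a) ** mpow P (Suc b)"
    by (simp add: matrix_mul_assoc)
  also have "trace (P ** mpow S a ** S ** mpow P b) = trace (mpow S (Suc a) ** mpow P (Suc b))"
    using trace_mul_sym [of P "mpow S a ** S ** mpow P b"] by (simp add: mpow_ac)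
  also have "trace (P ** mpow S a ** P ** mpow P b) = trace (mpow S a ** mpow P (Suc (Suc b)))"
    using trace_mul_sym [of P "mpow S a ** P ** mpow P b"] by (simp add: mpow_ac)
  finally show ?thesis by simp
qed

text \<open>The convex sequence \<open>i \<mapsto> tr(S\<^sup>i P\<^bsup>n - i\<^esup>)\<close> replaces the spectral theorem in the proof of
  Klein's inequality.\<close>

lemma trace_mpow_diff_le:
  assumes "psd S" "psd P"
  shows "trace (mpow S n) - trace (mpow P n) \<le> real n * trace (mpow S (n - 1) ** (S - P))"
proof (cases n)
  case 0 then show ?thesis by simp
next
  case (Suc k)
  define T where "T i = trace (mpow S i ** mpow P (n - i))" for i
  have "T n - T 0 \<le> real n * (T n - T (n - 1))"
  proof (rule convex_seq_backward_diff)
    fix i assume "Suc (Suc i) \<le> n"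
    then obtain b where b: "n = Suc (Suc i) + b" using le_Suc_ex by blast
    show "0 \<le> T (Suc (Suc i)) - 2 * T (Suc i) + T i"
      using trace_mixed_powers_convex [OF assms, of i b] by (simp add: T_def b Suc_diff_le)
  qed
  then show ?thesis
    by (simp add: T_def Suc matrix_diff_ldistrib trace_sub mpow_commute)
qed

text \<open>The tangent inequality is used at the convex combination S, towards P and towards Q. In
  the weighted sum the linear terms cancel, since t (S - P) + (1 - t) (S - Q) = 0.\<close>

lemma convex_trace_mpow:
  assumes "psd P" "psd Q" "0 \<le> t" "t \<le> 1"
  shows "trace (mpow (t *\<^sub>R P + (1 - t) *\<^sub>R Q) n) \<le> t * trace (mpow P n) + (1 - t) * trace (mpow Q n)"
proof -
  define S where "S = t *\<^sub>R P + (1 - t) *\<^sub>R Q"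
  have S: "psd S" unfolding S_def using assms by (intro psd_add psd_scaleR) auto
  define M where "M = mpow S (n - 1)"
  have 1: "t * (trace (mpow S n) - trace (mpow P n)) \<le> t * (real n * trace (M ** (S - P)))"
    unfolding M_def using assms S by (intro mult_left_mono trace_mpow_diff_le) auto
  have 2: "(1 - t) * (trace (mpow S n) - trace (mpow Q n)) \<le> (1 - t) * (real n * trace (M ** (S - Q)))"
    unfolding M_def using assms S by (intro mult_left_mono trace_mpow_diff_le) auto
  have "t * trace (M ** (S - P)) + (1 - t) * trace (M ** (S - Q))
      = trace (M ** (t *\<^sub>R (S - P) + (1 - t) *\<^sub>R (S - Q)))"
    by (simp add: matrix_add_ldistrib trace_add matrix_scaleR_right trace_scaleR)
  also have "t *\<^sub>R (S - P) + (1 - t) *\<^sub>R (S - Q) = 0"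
    by (simp add: S_def algebra_simps)
  finally have "t * trace (M ** (S - P)) + (1 - t) * trace (M ** (S - Q)) = 0"
    by (simp add: matrix_zero_right trace_zero)
  then have "real n * (t * trace (M ** (S - P)) + (1 - t) * trace (M ** (S - Q))) = 0"
    by simp
  then have "t * (real n * trace (M ** (S - P))) + (1 - t) * (real n * trace (M ** (S - Q))) = 0"
    by (simp add: algebra_simps)
  with 1 2 have "t * (trace (mpow S n) - trace (mpow P n)) + (1 - t) * (trace (mpow S n) - trace (mpow Q n)) \<le> 0"
    by linarith
  then have "trace (mpow S n) \<le> t * trace (mpow P n) + (1 - t) * trace (mpow Q n)"
    by (simp add: algebra_simps)
  then show ?thesis by (simp add: S_def)
qed

text \<open>Although v v^T is below R times the identity, matrix powers do not preserve this order,
  so the comparison is made only in the direction v. Carrying along an extra factor C^i gives closed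
  recursions in n for both sides, and these can be compared term by term.\<close>

lemma quad_mpow_rank_one_update_le:
  fixes C :: "real ^ 'n ^ 'n"
  assumes C: "psd C" and v: "v \<bullet> v \<le> R"
  shows "v \<bullet> (mpow (C + outer v) n *v v) \<le> v \<bullet> (mpow (C + R *\<^sub>R mat 1) n *v v)"
proof -
  define D where "D = C + R *\<^sub>R mat 1"
  define \<mu> where "\<mu> i = v \<bullet> (mpow C i *v v)" for i
  define d where "d i n = v \<bullet> ((mpow C i ** mpow D n) *v v)" for i n
  define e where "e i n = v \<bullet> ((mpow C i ** mpow (C + outer v) n) *v v)" for i n
  have R: "0 \<le> R" using v inner_ge_zero order_trans by blast
  have dS: "d i (Suc n) = d (Suc i) n + R * d i n" for i n
  proof -
    have "mpow C i ** mpow D (Suc n) = mpow C (Suc i) ** mpow D n + R *\<^sub>R (mpow C i ** mpow D n)"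
    proof -
      have "D ** X = C ** X + R *\<^sub>R X" for X :: "real ^ 'n ^ 'n"
        by (simp add: D_def matrix_add_rdistrib matrix_scaleR_left)
      then have "mpow C i ** mpow D (Suc n) = (mpow C i ** C) ** mpow D n + R *\<^sub>R (mpow C i ** mpow D n)"
        by (simp add: matrix_add_ldistrib matrix_scaleR_right matrix_mul_assoc)
      then show ?thesis by (simp add: mpow_commute)
    qed
    then show ?thesis
      by (simp add: d_def matrix_vector_mult_add_rdistrib matrix_scaleR_vector inner_add_right)
  qed
  have eS: "e i (Suc n) = e (Suc i) n + \<mu> i * e 0 n" for i n
  proof -
    have "mpow C i ** mpow (C + outer v) (Suc n)
       = mpow C (Suc i) ** mpow (C + outer v) n + mpow C i ** outer v ** mpow (C + outer v) n"
    proof -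
      have "mpow C i ** mpow (C + outer v) (Suc n)
         = mpow C i ** (C ** mpow (C + outer v) n) + mpow C i ** (outer v ** mpow (C + outer v) n)"
        by (simp only: mpow.simps matrix_add_rdistrib matrix_add_ldistrib)
      then show ?thesis by (simp add: mpow_commute matrix_mul_assoc)
    qed
    then show ?thesis
      by (simp add: e_def \<mu>_def matrix_vector_mult_add_rdistrib inner_add_right
          matrix_vector_mul_assoc [symmetric] outer_mult_vec matrix_vector_scaleR mult.commute)
  qed
  have d0: "d i 0 = \<mu> i" for i by (simp add: d_def \<mu>_def)
  have e0: "e i 0 = \<mu> i" for i by (simp add: e_def \<mu>_def)
  have \<mu>: "0 \<le> \<mu> i" for i by (simp add: \<mu>_def psd_quad psd_mpow C)
  \<comment> \<open>This is what separates the two recursions: one adds \<mu>_i times the value at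
    index 0, the other R times the value at index i. For n = 0 it is the moment inequality.\<close>
  have md: "\<mu> i * d j n \<le> R * d (i + j) n" for i j n
  proof (induction n arbitrary: j)
    case 0
    have "\<mu> i * \<mu> j \<le> (v \<bullet> v) * \<mu> (i + j)"
      unfolding \<mu>_def by (rule psd_moments_mult_le [OF C])
    also have "\<dots> \<le> R * \<mu> (i + j)" using v \<mu> by (intro mult_right_mono)
    finally show ?case by (simp add: d0)
  next
    case (Suc n)
    have "\<mu> i * d j (Suc n) = \<mu> i * d (Suc j) n + R * (\<mu> i * d j n)"
      by (simp add: dS algebra_simps)
    also have "\<dots> \<le> R * d (i + Suc j) n + R * (R * d (i + j) n)"
      by (intro add_mono Suc mult_left_mono R)
    finally show ?case by (simp add: dS algebra_simps)
  qed
  have "e i n \<le> d i n" for i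
  proof (induction n arbitrary: i)
    case (Suc n)
    have "e i (Suc n) \<le> d (Suc i) n + \<mu> i * d 0 n"
      unfolding eS by (intro add_mono Suc mult_left_mono \<mu>)
    also have "\<dots> \<le> d (Suc i) n + R * d i n" using md [of i 0 n] by simp
    finally show ?case by (simp add: dS)
  qed (simp add: d0 e0)
  from this [of 0] show ?thesis by (simp add: d_def e_def D_def)
qed

text \<open>For a rank-one update this plays the role of the Golden--Thompson inequality.\<close>

lemma trace_mpow_rank_one_update_le:
  assumes C: "psd C" and v: "v \<bullet> v \<le> R"
  shows "trace (mpow (C + outer v) n)
    \<le> trace (mpow C n) + real n * (v \<bullet> (mpow (C + R *\<^sub>R mat 1) (n - 1) *v v))"
proof -
  have "trace (mpow (C + outer v) n) - trace (mpow C n)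
      \<le> real n * trace (mpow (C + outer v) (n - 1) ** (C + outer v - C))"
    by (intro trace_mpow_diff_le psd_add psd_outer C)
  also have "\<dots> = real n * (v \<bullet> (mpow (C + outer v) (n - 1) *v v))"
    by (simp add: trace_outer_mult)
  also have "\<dots> \<le> real n * (v \<bullet> (mpow (C + R *\<^sub>R mat 1) (n - 1) *v v))"
    by (intro mult_left_mono quad_mpow_rank_one_update_le C v) auto
  finally show ?thesis by simp
qed

section \<open>Uniform averages, and permutations versus independent indices\<close>

text \<open>All sources of randomness are finite and uniform, so expectations are finite sums and
  exchanging them needs no integrability. The link to the probability is made in
  \<open>prob_random_source\<close>.\<close>

definition avg :: "'a set \<Rightarrow> ('a \<Rightarrow> real) \<Rightarrow> real" where
  "avg S f = (\<Sum>s\<in>S. f s) / real (card S)"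

lemma avg_mono: "(\<And>s. s \<in> S \<Longrightarrow> f s \<le> g s) \<Longrightarrow> avg S f \<le> avg S g"
  by (auto simp: avg_def intro!: divide_right_mono sum_mono)

lemma avg_nonneg: "(\<And>s. s \<in> S \<Longrightarrow> 0 \<le> f s) \<Longrightarrow> 0 \<le> avg S f"
  by (auto simp: avg_def intro!: divide_nonneg_nonneg sum_nonneg)

lemma avg_cong: "(\<And>s. s \<in> S \<Longrightarrow> f s = g s) \<Longrightarrow> avg S f = avg S g"
  by (auto simp: avg_def intro!: sum.cong arg_cong [of _ _ "\<lambda>x. x / _"])

lemma avg_add: "avg S (\<lambda>s. f s + g s) = avg S f + avg S g"
  by (simp add: avg_def sum.distrib add_divide_distrib)

lemma avg_cmult: "avg S (\<lambda>s. c * f s) = c * avg S f"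
  by (simp add: avg_def sum_distrib_left)

lemma avg_sum: "avg S (\<lambda>s. \<Sum>i\<in>I. f i s) = (\<Sum>i\<in>I. avg S (f i))"
  by (simp add: avg_def sum_divide_distrib [symmetric] sum.swap [of _ I])

lemma avg_const: "finite S \<Longrightarrow> S \<noteq> {} \<Longrightarrow> avg S (\<lambda>_. c) = c"
  by (simp add: avg_def)

lemma avg_signs_const: "avg (sign_vectors :: (real ^ 'd::finite) set) (\<lambda>_. c) = c"
  by (intro avg_const sign_vectors_finite_nonempty)

lemma avg_permutations_const: "avg {\<pi> :: 'd::finite \<Rightarrow> 'd. \<pi> permutes UNIV} (\<lambda>_. c) = c"
  by (intro avg_const permutations_finite_nonempty)

lemma avg_reindex: "bij_betw h S T \<Longrightarrow> avg T f = avg S (\<lambda>s. f (h s))"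
  by (simp add: avg_def sum.reindex_bij_betw bij_betw_same_card)

lemma avg_swap: "avg S (\<lambda>s. avg T (\<lambda>t. f s t)) = avg T (\<lambda>t. avg S (\<lambda>s. f s t))"
  by (simp add: avg_def sum_divide_distrib [symmetric] sum.swap [of _ S] mult.commute)

lemma avg_Times: "avg (S \<times> T) f = avg S (\<lambda>s. avg T (\<lambda>t. f (s, t)))"
  by (simp add: avg_def sum_divide_distrib [symmetric] sum.cartesian_product card_cartesian_product
      mult.commute)

text \<open>Redrawing one value of a uniform function leaves it uniform: exchanging
  \<open>K j\<close> with the fresh value k is an involution on the pairs (K, k). It isolates one
  independent index.\<close>

lemma avg_resample:
  fixes f :: "('a::finite \<Rightarrow> 'b::finite) \<Rightarrow> real"
  shows "avg UNIV f = avg UNIV (\<lambda>K. avg UNIV (\<lambda>k. f (K(j := k))))"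
proof -
  have "(\<Sum>K\<in>UNIV. \<Sum>k\<in>UNIV. f (K(j := k))) = (\<Sum>(K, k)\<in>UNIV \<times> UNIV. f (K(j := k)))"
    by (simp add: sum.cartesian_product)
  also have "\<dots> = (\<Sum>(K, k :: 'b)\<in>UNIV \<times> UNIV. f K)"
    by (rule sum.reindex_bij_witness [of _ "\<lambda>(K, k). (K(j := k), K j)" "\<lambda>(K, k). (K(j := k), K j)"])
      auto
  also have "\<dots> = real CARD('b) * (\<Sum>K\<in>UNIV. f K)"
    by (subst sum.cartesian_product [symmetric]) (simp add: sum_distrib_left)
  finally show ?thesis
    by (simp add: avg_def sum_divide_distrib [symmetric])
qed

lemma avg_prod_fun:
  fixes p :: "'a::finite \<Rightarrow> 'b::finite \<Rightarrow> real"
  assumes "finite J"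
  shows "avg UNIV (\<lambda>K. \<Prod>j\<in>J. p j (K j)) = (\<Prod>j\<in>J. avg UNIV (p j))"
  using assms
proof (induction J)
  case empty
  show ?case by (simp add: avg_const)
next
  case (insert i J)
  have "avg UNIV (\<lambda>K. \<Prod>j\<in>insert i J. p j (K j))
     = avg UNIV (\<lambda>K. avg UNIV (\<lambda>k. (\<Prod>j\<in>J. p j (K j)) * p i k))"
  proof (subst avg_resample [of _ i], intro avg_cong)
    fix K k
    have "(\<Prod>j\<in>J. p j ((K(i := k)) j)) = (\<Prod>j\<in>J. p j (K j))"
      using insert.hyps by (intro prod.cong) auto
    then show "(\<Prod>j\<in>insert i J. p j ((K(i := k)) j)) = (\<Prod>j\<in>J. p j (K j)) * p i k"
      using insert.hyps by (simp add: mult.commute del: fun_upd_apply) simp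
  qed
  also have "\<dots> = avg UNIV (\<lambda>K. avg UNIV (p i) * (\<Prod>j\<in>J. p j (K j)))"
    by (simp only: avg_cmult mult.commute [of _ "avg UNIV (p i)"])
  finally show ?case using insert by (simp add: avg_cmult)
qed

section \<open>Majorization, and sampling with and without replacement\<close>

text \<open>Merging two coordinates of a vector makes it larger in the majorization order.\<close>

lemma symmetric_convex_merge_le:
  fixes g :: "('d::finite \<Rightarrow> real) \<Rightarrow> real" and r :: "'d \<Rightarrow> 'd"
  assumes sym: "\<And>v \<sigma>. \<sigma> permutes UNIV \<Longrightarrow> g (v \<circ> \<sigma>) = g v"
    and conv: "\<And>v w t. \<forall>k. 0 \<le> v k \<Longrightarrow> \<forall>k. 0 \<le> w k \<Longrightarrow> 0 \<le> t \<Longrightarrow> t \<le> 1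
      \<Longrightarrow> g (\<lambda>k. t * v k + (1 - t) * w k) \<le> t * g v + (1 - t) * g w"
    and u: "\<And>k. 0 \<le> u k"
  shows "g u \<le> g (\<lambda>k. \<Sum>j | r j = k. u j)"
\<comment> \<open>Induction on the number of values that r misses. An injective r only permutes the
  weights; otherwise one of two colliding indices is moved to a missed value k0, which enlarges the
  range by one.\<close>
proof (induction "CARD('d) - card (range r)" arbitrary: r rule: less_induct)
  case less
  show ?case
  proof (cases "inj r")
    case True
    then have b: "bij r" by (simp add: finite_UNIV_inj_surj bij_def)
    have "(\<lambda>k. \<Sum>j | r j = k. u j) = u \<circ> inv r"
    proof
      fix k
      have "{j. r j = k} = {inv r k}"
        using b by (auto simp: bij_def surj_f_inv_f)
      then show "(\<Sum>j | r j = k. u j) = (u \<circ> inv r) k" by simp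
    qed
    moreover have "inv r permutes UNIV" using b by (intro bij_imp_permutes bij_imp_bij_inv) auto
    ultimately show ?thesis using sym by simp
  next
    case False
    then obtain j j' where j: "r j = r j'" "j \<noteq> j'" by (auto simp: inj_def)
    have "\<not> surj r" using False finite_UNIV_surj_inj [of r] by auto
    then obtain k0 where k0: "k0 \<notin> range r" by blast
    define r' where "r' = r(j := k0)"
    define k1 where "k1 = r j"
    have ne: "k0 \<noteq> k1" using k0 by (auto simp: k1_def)
    have "range r' = insert k0 (range r)"
    proof
      show "range r' \<subseteq> insert k0 (range r)" by (auto simp: r'_def)
      have "r x \<in> range r'" for x
      proof (cases "x = j")
        case True
        then have "r x = r' j'" using j by (simp add: r'_def)
        then show ?thesis by simp
      next
        case False
        then have "r x = r' x" by (simp add: r'_def)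
        then show ?thesis by simp
      qed
      moreover have "k0 = r' j" by (simp add: r'_def)
      ultimately show "insert k0 (range r) \<subseteq> range r'" by auto
    qed
    then have c: "card (range r') = Suc (card (range r))" using k0 by simp
    have "card (range r') \<le> CARD('d)" by (rule card_mono) auto
    with c have "g u \<le> g (\<lambda>k. \<Sum>j | r' j = k. u j)" by (intro less) simp
    also have "\<dots> \<le> g (\<lambda>k. \<Sum>j | r j = k. u j)"
    proof -
      define v where "v k = (\<Sum>j | r j = k. u j)" for k
      define v' where "v' k = (\<Sum>j | r' j = k. u j)" for k
      have v: "0 \<le> v k" for k by (simp add: v_def sum_nonneg u)
      have vk0: "v k0 = 0"
      proof -
        have "{j. r j = k0} = {}" using k0 by auto
        then show ?thesis unfolding v_def by (metis sum.empty)
      qed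
      have v'k0: "v' k0 = u j"
      proof -
        have "{i. r' i = k0} = {j}" using k0 by (auto simp: r'_def)
        then show ?thesis by (simp add: v'_def)
      qed
      have v'k1: "v' k1 = v k1 - u j"
      proof -
        have "{i. r' i = k1} = {i. r i = k1} - {j}" using ne by (auto simp: r'_def)
        moreover have "j \<in> {i. r i = k1}" by (simp add: k1_def)
        ultimately show ?thesis by (simp add: v'_def v_def sum_diff1)
      qed
      have v'o: "v' k = v k" if "k \<noteq> k0" "k \<noteq> k1" for k
      proof -
        have "{i. r' i = k} = {i. r i = k}" using that by (auto simp: r'_def k1_def)
        then show ?thesis by (simp add: v'_def v_def)
      qed
      have uj: "u j \<le> v k1"
        unfolding v_def by (rule member_le_sum) (auto simp: k1_def u)
      \<comment> \<open>Moving j splits the mass v k1 into v k1 - u j at k1 and u j at the formerly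
        empty k0. This is the mixture, with weight t, of v and v with k0 and k1 exchanged. If v k1 =
        0 then u j = 0 as well and t = 1 serves.\<close>
      define t where "t = (if v k1 = 0 then 1 else (v k1 - u j) / v k1)"
      have t: "0 \<le> t" "t \<le> 1" "t * v k1 = v k1 - u j"
        using uj u [of j] v [of k1] by (auto simp: t_def divide_simps)
      let ?\<tau> = "Transposition.transpose k0 k1"
      have v'_eq: "v' = (\<lambda>k. t * v k + (1 - t) * (v \<circ> ?\<tau>) k)"
      proof
        fix k
        show "v' k = t * v k + (1 - t) * (v \<circ> ?\<tau>) k"
        proof (cases "k = k0")
          case True
          then show ?thesis using t by (simp add: vk0 v'k0 algebra_simps)
        next
          case False
          show ?thesis
          proof (cases "k = k1")
            case True
            then show ?thesis using t by (simp add: vk0 v'k1)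
          next
            case F2: False
            then show ?thesis using False by (simp add: v'o transpose_apply_other algebra_simps)
          qed
        qed
      qed
      have "g v' \<le> t * g v + (1 - t) * g (v \<circ> ?\<tau>)"
        unfolding v'_eq using v t by (intro conv) auto
      also have "\<dots> = g v"
        by (simp add: sym permutes_swap_id algebra_simps)
      finally show ?thesis by (simp only: v_def [abs_def] v'_def [abs_def])
    qed
    finally show ?thesis .
  qed
qed

lemma bij_betw_permutes_comp:
  assumes "\<rho> permutes S"
  shows "bij_betw (\<lambda>\<sigma>. \<sigma> \<circ> \<rho>) {\<sigma>. \<sigma> permutes S} {\<sigma>. \<sigma> permutes S}"
  by (rule bij_betw_byWitness [where f' = "\<lambda>\<sigma>. \<sigma> \<circ> inv \<rho>"])
    (auto simp: assms permutes_compose permutes_inv comp_assoc permutes_inv_o [OF assms])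

lemma bij_betw_permutes_inv: "bij_betw inv {\<sigma>. \<sigma> permutes S} {\<sigma>. \<sigma> permutes S}"
  by (rule bij_betw_byWitness [where f' = inv]) (auto simp: permutes_inv permutes_inv_inv)

text \<open>Hoeffding's comparison: replacing the permutation by an arbitrary index map merges those weights
  that are sent to the same index.\<close>

lemma avg_permutation_le_avg_function:
  fixes f :: "'a::real_vector \<Rightarrow> real" and H :: "'d::finite \<Rightarrow> 'a"
  assumes Q: "\<And>v (\<sigma> :: 'd \<Rightarrow> 'd). \<forall>k. 0 \<le> v k \<Longrightarrow> Q (\<Sum>k\<in>UNIV. v k *\<^sub>R H (\<sigma> k))"
    and conv: "\<And>a b t. Q a \<Longrightarrow> Q b \<Longrightarrow> 0 \<le> t \<Longrightarrow> t \<le> 1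
      \<Longrightarrow> f (t *\<^sub>R a + (1 - t) *\<^sub>R b) \<le> t * f a + (1 - t) * f b"
    and u: "\<And>k. 0 \<le> u k"
  shows "avg {\<pi>. \<pi> permutes UNIV} (\<lambda>\<pi>. f (\<Sum>k\<in>UNIV. u (\<pi> k) *\<^sub>R H k))
     \<le> avg UNIV (\<lambda>K. f (\<Sum>j\<in>UNIV. u j *\<^sub>R H (K j)))"
proof -
  let ?P = "{\<pi> :: 'd \<Rightarrow> 'd. \<pi> permutes UNIV}"
  \<comment> \<open>Averaging over \<sigma> makes the functional symmetric in the weights while
    keeping convexity, which is what merging requires.\<close>
  define g where "g v = avg ?P (\<lambda>\<sigma>. f (\<Sum>k\<in>UNIV. v k *\<^sub>R H (\<sigma> k)))" for v :: "'d \<Rightarrow> real"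
  have sym: "g (v \<circ> \<rho>) = g v" if "\<rho> permutes UNIV" for v \<rho>
  proof -
    have "g v = avg ?P (\<lambda>\<sigma>. f (\<Sum>k\<in>UNIV. v k *\<^sub>R H ((\<sigma> \<circ> inv \<rho>) k)))"
      unfolding g_def by (intro avg_reindex bij_betw_permutes_comp permutes_inv that)
    also have "\<dots> = g (v \<circ> \<rho>)"
      unfolding g_def
    proof (intro avg_cong arg_cong [of _ _ f])
      fix \<sigma>
      show "(\<Sum>k\<in>UNIV. v k *\<^sub>R H ((\<sigma> \<circ> inv \<rho>) k)) = (\<Sum>k\<in>UNIV. (v \<circ> \<rho>) k *\<^sub>R H (\<sigma> k))"
        by (subst sum.permute [OF that]) (simp add: o_def permutes_inverses [OF that])
    qed
    finally show ?thesis by simp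
  qed
  have gconv: "g (\<lambda>k. t * v k + (1 - t) * w k) \<le> t * g v + (1 - t) * g w"
    if "\<forall>k. 0 \<le> v k" "\<forall>k. 0 \<le> w k" "0 \<le> t" "t \<le> 1" for v w t
    unfolding g_def avg_cmult [symmetric] avg_add [symmetric]
  proof (intro avg_mono)
    fix \<sigma>
    have "(\<Sum>k\<in>UNIV. (t * v k + (1 - t) * w k) *\<^sub>R H (\<sigma> k))
      = t *\<^sub>R (\<Sum>k\<in>UNIV. v k *\<^sub>R H (\<sigma> k)) + (1 - t) *\<^sub>R (\<Sum>k\<in>UNIV. w k *\<^sub>R H (\<sigma> k))"
      by (simp add: scaleR_sum_right sum.distrib [symmetric] scaleR_add_left)
    then show "f (\<Sum>k\<in>UNIV. (t * v k + (1 - t) * w k) *\<^sub>R H (\<sigma> k))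
      \<le> t * f (\<Sum>k\<in>UNIV. v k *\<^sub>R H (\<sigma> k)) + (1 - t) * f (\<Sum>k\<in>UNIV. w k *\<^sub>R H (\<sigma> k))"
      using conv [OF Q [OF that(1)] Q [OF that(2)] that(3,4)] by simp
  qed
  have merge: "g u \<le> g (\<lambda>k. \<Sum>j | r j = k. u j)" for r
    by (rule symmetric_convex_merge_le [where g = g and u = u and r = r, OF sym gconv u])
  have push: "g (\<lambda>k. \<Sum>j | r j = k. u j) = avg ?P (\<lambda>\<sigma>. f (\<Sum>j\<in>UNIV. u j *\<^sub>R H (\<sigma> (r j))))" for r
    unfolding g_def
  proof (intro avg_cong arg_cong [of _ _ f])
    fix \<sigma>
    have "(\<Sum>k\<in>UNIV. (\<Sum>j | r j = k. u j) *\<^sub>R H (\<sigma> k)) = (\<Sum>k\<in>UNIV. \<Sum>j | r j = k. u j *\<^sub>R H (\<sigma> (r j)))"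
      by (simp add: scaleR_sum_left)
    also have "\<dots> = (\<Sum>j\<in>UNIV. u j *\<^sub>R H (\<sigma> (r j)))"
      using sum.group [of UNIV UNIV r "\<lambda>j. u j *\<^sub>R H (\<sigma> (r j))"] by simp
    finally show "(\<Sum>k\<in>UNIV. (\<Sum>j | r j = k. u j) *\<^sub>R H (\<sigma> k)) = (\<Sum>j\<in>UNIV. u j *\<^sub>R H (\<sigma> (r j)))" .
  qed
  \<comment> \<open>Passing to the inverse permutation moves the randomness from the weights to the
    vectors H.\<close>
  have "avg ?P (\<lambda>\<pi>. f (\<Sum>k\<in>UNIV. u (\<pi> k) *\<^sub>R H k)) = avg ?P (\<lambda>\<pi>. f (\<Sum>k\<in>UNIV. u (inv \<pi> k) *\<^sub>R H k))"
    by (intro avg_reindex bij_betw_permutes_inv)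
  also have "\<dots> = g u"
    unfolding g_def
  proof (intro avg_cong arg_cong [of _ _ f])
    fix \<sigma> assume "\<sigma> \<in> ?P"
    then have \<sigma>: "\<sigma> permutes UNIV" by simp
    show "(\<Sum>k\<in>UNIV. u (inv \<sigma> k) *\<^sub>R H k) = (\<Sum>k\<in>UNIV. u k *\<^sub>R H (\<sigma> k))"
      by (subst sum.permute [OF \<sigma>]) (simp add: o_def permutes_inverses [OF \<sigma>])
  qed
  \<comment> \<open>The merging bound holds for every r, hence also on average over a uniform r. For
    each fixed \<sigma> the composite of \<sigma> with r is again a uniform index map, so \<sigma>
    disappears.\<close>
  also have "\<dots> = avg (UNIV :: ('d \<Rightarrow> 'd) set) (\<lambda>r. g u)"
    by (simp add: avg_const)
  also have "\<dots> \<le> avg UNIV (\<lambda>r. avg ?P (\<lambda>\<sigma>. f (\<Sum>j\<in>UNIV. u j *\<^sub>R H (\<sigma> (r j)))))"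
    using merge push by (intro avg_mono) simp
  also have "\<dots> = avg ?P (\<lambda>\<sigma>. avg UNIV (\<lambda>r. f (\<Sum>j\<in>UNIV. u j *\<^sub>R H (\<sigma> (r j)))))"
    by (rule avg_swap)
  also have "\<dots> = avg ?P (\<lambda>\<sigma>. avg UNIV (\<lambda>K. f (\<Sum>j\<in>UNIV. u j *\<^sub>R H (K j))))"
  proof (rule avg_cong)
    fix \<sigma> assume "\<sigma> \<in> ?P"
    then have \<sigma>: "\<sigma> permutes UNIV" by simp
    have "bij_betw (\<lambda>r :: 'd \<Rightarrow> 'd. \<sigma> \<circ> r) UNIV UNIV"
      by (rule bij_betw_byWitness [where f' = "\<lambda>r. inv \<sigma> \<circ> r"])
        (auto simp: fun_eq_iff permutes_inverses [OF \<sigma>])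
    from avg_reindex [OF this, of "\<lambda>K. f (\<Sum>j\<in>UNIV. u j *\<^sub>R H (K j))"]
    show "avg UNIV (\<lambda>r. f (\<Sum>j\<in>UNIV. u j *\<^sub>R H (\<sigma> (r j)))) = avg UNIV (\<lambda>K. f (\<Sum>j\<in>UNIV. u j *\<^sub>R H (K j)))"
      by simp
  qed
  also have "\<dots> = avg UNIV (\<lambda>K. f (\<Sum>j\<in>UNIV. u j *\<^sub>R H (K j)))"
    by (rule avg_permutations_const)
  finally show ?thesis .
qed

section \<open>A matrix Chernoff bound for random permutations\<close>

lemma exp_partial_sum_le:
  assumes "0 \<le> (x :: real)"
  shows "(\<Sum>p\<le>P. x ^ p / fact p) \<le> exp x"
proof -
  have "(\<lambda>n. x ^ n / fact n) sums exp x"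
    using exp_converges [of x] by (simp add: field_simps)
  then show ?thesis
    using assms by (metis (no_types, lifting) sum_le_suminf sums_iff finite_atMost
        divide_nonneg_nonneg fact_ge_zero zero_le_power)
qed

text \<open>Truncating the series of \<open>tr exp(\<theta> C)\<close> makes all sums finite; the limit is taken only for the
  scalar bound.\<close>

definition trace_exp_partial :: "nat \<Rightarrow> real \<Rightarrow> real ^ 'n ^ 'n \<Rightarrow> real" where
  "trace_exp_partial P \<theta> C = (\<Sum>p\<le>P. \<theta> ^ p / fact p * trace (mpow C p))"

lemma mpow_scalar: "mpow (z *\<^sub>R mat 1) p = z ^ p *\<^sub>R (mat 1 :: real ^ 'n ^ 'n)"
  by (induction p) (auto simp: matrix_scaleR_left matrix_scaleR_right)

lemma trace_exp_partial_scalar_le: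
  assumes "0 \<le> z" "0 \<le> \<theta>"
  shows "trace_exp_partial P \<theta> (z *\<^sub>R mat 1 :: real ^ 'n ^ 'n) \<le> real CARD('n) * exp (\<theta> * z)"
proof -
  have "trace_exp_partial P \<theta> (z *\<^sub>R mat 1 :: real ^ 'n ^ 'n)
      = real CARD('n) * (\<Sum>p\<le>P. (\<theta> * z) ^ p / fact p)"
    by (simp add: trace_exp_partial_def mpow_scalar trace_scaleR trace_I sum_distrib_left
        power_mult_distrib mult_ac)
  also have "\<dots> \<le> real CARD('n) * exp (\<theta> * z)"
    using assms by (intro mult_left_mono exp_partial_sum_le) auto
  finally show ?thesis .
qed

lemma trace_exp_partial_convex:
  assumes "psd A" "psd B" "0 \<le> t" "t \<le> 1" "0 \<le> \<theta>"
  shows "trace_exp_partial P \<theta> (t *\<^sub>R A + (1 - t) *\<^sub>R B)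
    \<le> t * trace_exp_partial P \<theta> A + (1 - t) * trace_exp_partial P \<theta> B"
proof -
  have "trace_exp_partial P \<theta> (t *\<^sub>R A + (1 - t) *\<^sub>R B)
     \<le> (\<Sum>p\<le>P. \<theta> ^ p / fact p * (t * trace (mpow A p) + (1 - t) * trace (mpow B p)))"
    unfolding trace_exp_partial_def using assms by (intro sum_mono mult_left_mono convex_trace_mpow) auto
  also have "\<dots> = t * trace_exp_partial P \<theta> A + (1 - t) * trace_exp_partial P \<theta> B"
    by (simp add: trace_exp_partial_def sum_distrib_left sum.distrib [symmetric] algebra_simps
        add_divide_distrib diff_divide_distrib)
  finally show ?thesis .
qed

lemma sum_quad_eq_trace: "(\<Sum>k\<in>S. h k \<bullet> (M *v h k)) = trace (M ** (\<Sum>k\<in>S. outer (h k)))"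
  by (induction S rule: infinite_finite_induct)
    (auto simp: matrix_zero_right trace_zero matrix_add_ldistrib trace_add trace_outer_mult)

text \<open>By isotropy the average of h_k \<bullet> M h_k is c tr M, so one random rank-one update
  costs a multiple of the same functional. The price is the shift of C by R times the identity,
  inherited from the rank-one update bound.\<close>

lemma avg_trace_exp_partial_update_le:
  fixes h :: "'d::finite \<Rightarrow> real ^ 'n::finite"
  assumes iso: "(\<Sum>k\<in>UNIV. outer (h k)) = (real CARD('d) * c) *\<^sub>R mat 1"
    and s: "0 \<le> s" "\<And>k. s * (h k \<bullet> h k) \<le> R" and \<theta>: "0 \<le> \<theta>" and C: "psd C" and c: "0 \<le> c"
  shows "avg UNIV (\<lambda>k. trace_exp_partial P \<theta> (C + s *\<^sub>R outer (h k)))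
    \<le> trace_exp_partial P \<theta> C + s * c * \<theta> * trace_exp_partial P \<theta> (C + R *\<^sub>R mat 1)"
proof -
  let ?D = "C + R *\<^sub>R mat 1"
  \<comment> \<open>Index types are nonempty, so an arbitrary index already shows that R is
    nonnegative.\<close>
  have "0 \<le> s * (h undefined \<bullet> h undefined)" using s by simp
  then have R: "0 \<le> R" using s(2) [of undefined] by linarith
  have D: "psd ?D" by (intro psd_add psd_scaleR C psd_mat1 R)
  define X where "X p = trace (mpow ?D p)" for p
  have X: "0 \<le> X p" for p by (simp add: X_def trace_psd psd_mpow D)
  have one: "avg UNIV (\<lambda>k. trace (mpow (C + s *\<^sub>R outer (h k)) p))
    \<le> trace (mpow C p) + real p * (s * c * X (p - 1))" for p
  proof -
    have "avg UNIV (\<lambda>k. trace (mpow (C + s *\<^sub>R outer (h k)) p))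
      \<le> avg UNIV (\<lambda>k. trace (mpow C p) + (real p * s) * (h k \<bullet> (mpow ?D (p - 1) *v h k)))"
    proof (rule avg_mono)
      fix k
      have "trace (mpow (C + outer (sqrt s *\<^sub>R h k)) p)
        \<le> trace (mpow C p) + real p * ((sqrt s *\<^sub>R h k) \<bullet> (mpow ?D (p - 1) *v (sqrt s *\<^sub>R h k)))"
        using s by (intro trace_mpow_rank_one_update_le C) (simp add: mult.assoc [symmetric])
      then show "trace (mpow (C + s *\<^sub>R outer (h k)) p)
        \<le> trace (mpow C p) + (real p * s) * (h k \<bullet> (mpow ?D (p - 1) *v h k))"
        using s by (simp add: outer_scaleR matrix_vector_scaleR mult.assoc [symmetric])
    qed
    also have "\<dots> = trace (mpow C p) + (real p * s) * avg UNIV (\<lambda>k. h k \<bullet> (mpow ?D (p - 1) *v h k))"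
      by (simp add: avg_add avg_cmult avg_const)
    also have "avg UNIV (\<lambda>k. h k \<bullet> (mpow ?D (p - 1) *v h k)) = c * X (p - 1)"
      by (simp add: avg_def sum_quad_eq_trace iso matrix_scaleR_right trace_scaleR X_def)
    finally show ?thesis by (simp add: mult_ac)
  qed
  have "avg UNIV (\<lambda>k. trace_exp_partial P \<theta> (C + s *\<^sub>R outer (h k)))
     = (\<Sum>p\<le>P. \<theta> ^ p / fact p * avg UNIV (\<lambda>k. trace (mpow (C + s *\<^sub>R outer (h k)) p)))"
    by (simp only: trace_exp_partial_def avg_sum avg_cmult)
  also have "\<dots> \<le> (\<Sum>p\<le>P. \<theta> ^ p / fact p * (trace (mpow C p) + real p * (s * c * X (p - 1))))"
    using \<theta> one by (intro sum_mono mult_left_mono) auto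
  also have "\<dots> = trace_exp_partial P \<theta> C + s * c * (\<Sum>p\<le>P. \<theta> ^ p / fact p * real p * X (p - 1))"
    by (simp add: trace_exp_partial_def sum.distrib [symmetric] sum_distrib_left algebra_simps)
  \<comment> \<open>The factor p lowers the factorial, which is differentiation of the exponential
    series. The p = 0 term vanishes, and the shifted sum ends one index earlier, so it may be
    completed by a nonnegative term.\<close>
  also have "(\<Sum>p\<le>P. \<theta> ^ p / fact p * real p * X (p - 1)) \<le> \<theta> * trace_exp_partial P \<theta> ?D"
  proof (cases P)
    case 0
    then show ?thesis using \<theta> X [of 0] by (simp add: trace_exp_partial_def X_def)
  next
    case (Suc P')
    have "(\<Sum>p\<le>P. \<theta> ^ p / fact p * real p * X (p - 1))
      = (\<Sum>p\<le>P'. \<theta> ^ Suc p / fact (Suc p) * real (Suc p) * X p)"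
      unfolding Suc by (subst sum.atMost_Suc_shift) simp
    also have "\<dots> = \<theta> * (\<Sum>p\<le>P'. \<theta> ^ p / fact p * X p)"
      by (simp add: sum_distrib_left field_simps del: of_nat_Suc)
    also have "\<dots> \<le> \<theta> * (\<Sum>p\<le>P. \<theta> ^ p / fact p * X p)"
      using \<theta> X by (intro mult_left_mono sum_mono2) (auto simp: Suc)
    finally show ?thesis by (simp add: trace_exp_partial_def X_def)
  qed
  finally show ?thesis
    using s c by (simp add: mult_left_mono mult.assoc)
qed

text \<open>The induction must allow a scalar shift z, because removing an index leaves one term at
  z and one at z + R. In the bound the second is the first times exp(\<theta> R), so every index
  contributes one factor; the dimension enters only through the trace of the identity at the
  end.\<close>

lemma avg_trace_exp_partial_le:
  fixes h :: "'d::finite \<Rightarrow> real ^ 'n::finite"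
  assumes iso: "(\<Sum>k\<in>UNIV. outer (h k)) = (real CARD('d) * c) *\<^sub>R mat 1"
    and u: "\<And>j. 0 \<le> u j" "\<And>j k. u j * (h k \<bullet> h k) \<le> R" and \<theta>: "0 \<le> \<theta>" and c: "0 \<le> c"
    and J: "finite (J :: 'd set)" and z: "0 \<le> z"
  shows "avg UNIV (\<lambda>K. trace_exp_partial P \<theta> (z *\<^sub>R mat 1 + (\<Sum>j\<in>J. u j *\<^sub>R outer (h (K j)))))
    \<le> real CARD('n) * exp (\<theta> * z) * (\<Prod>j\<in>J. 1 + u j * c * \<theta> * exp (\<theta> * R))"
  using J z
proof (induction J arbitrary: z)
  case empty
  then show ?case using \<theta> by (simp add: avg_const trace_exp_partial_scalar_le)
next
  case (insert i J)
  let ?S = "\<lambda>K. \<Sum>j\<in>J. u j *\<^sub>R outer (h (K j))"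
  let ?G = "trace_exp_partial P \<theta> :: real ^ 'n ^ 'n \<Rightarrow> real"
  let ?M = "real CARD('n) * exp (\<theta> * z) * (\<Prod>j\<in>J. 1 + u j * c * \<theta> * exp (\<theta> * R))"
  have "0 \<le> u undefined * (h undefined \<bullet> h undefined)" using u by simp
  then have R: "0 \<le> R" using u(2) [of undefined undefined] by linarith
  have "avg UNIV (\<lambda>K. ?G (z *\<^sub>R mat 1 + (\<Sum>j\<in>insert i J. u j *\<^sub>R outer (h (K j)))))
      = avg UNIV (\<lambda>K. avg UNIV (\<lambda>k. ?G (z *\<^sub>R mat 1 + ?S K + u i *\<^sub>R outer (h k))))"
  proof (subst avg_resample [of _ i], intro avg_cong arg_cong [of _ _ ?G])
    fix K k
    have "?S (K(i := k)) = ?S K"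
      using insert.hyps by (intro sum.cong) auto
    then show "z *\<^sub>R mat 1 + (\<Sum>j\<in>insert i J. u j *\<^sub>R outer (h ((K(i := k)) j)))
       = z *\<^sub>R mat 1 + ?S K + u i *\<^sub>R outer (h k)"
      using insert.hyps by (simp add: add_ac del: fun_upd_apply) simp
  qed
  also have "\<dots> \<le> avg UNIV (\<lambda>K. ?G (z *\<^sub>R mat 1 + ?S K)
      + u i * c * \<theta> * ?G ((z + R) *\<^sub>R mat 1 + ?S K))"
  proof (rule avg_mono)
    fix K
    have "psd (z *\<^sub>R mat 1 + ?S K)"
      by (intro psd_add psd_sum psd_scaleR psd_mat1 psd_outer u insert.prems)
    from avg_trace_exp_partial_update_le [OF iso u(1) [of i] u(2) [of i] \<theta> this c, where P = P]
    show "avg UNIV (\<lambda>k. ?G (z *\<^sub>R mat 1 + ?S K + u i *\<^sub>R outer (h k)))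
      \<le> ?G (z *\<^sub>R mat 1 + ?S K) + u i * c * \<theta> * ?G ((z + R) *\<^sub>R mat 1 + ?S K)"
      by (simp add: scaleR_add_left add_ac)
  qed
  also have "\<dots> = avg UNIV (\<lambda>K. ?G (z *\<^sub>R mat 1 + ?S K))
      + u i * c * \<theta> * avg UNIV (\<lambda>K. ?G ((z + R) *\<^sub>R mat 1 + ?S K))"
    by (simp only: avg_add avg_cmult)
  also have "\<dots> \<le> ?M + u i * c * \<theta> *
      (real CARD('n) * exp (\<theta> * (z + R)) * (\<Prod>j\<in>J. 1 + u j * c * \<theta> * exp (\<theta> * R)))"
    using insert.IH [OF insert.prems] insert.IH [of "z + R"] R u c \<theta> insert.prems
    by (intro add_mono mult_left_mono) auto
  also have "\<dots> = ?M * (1 + u i * c * \<theta> * exp (\<theta> * R))"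
    by (simp add: exp_add algebra_simps)
  finally show ?case using insert.hyps by (simp add: mult_ac)
qed

lemma prod_one_plus_le_exp:
  fixes x :: "'a \<Rightarrow> real"
  assumes "\<And>j. j \<in> J \<Longrightarrow> -1 \<le> x j"
  shows "(\<Prod>j\<in>J. 1 + x j) \<le> exp (\<Sum>j\<in>J. x j)"
proof (cases "finite J")
  case True
  have "(\<Prod>j\<in>J. 1 + x j) \<le> (\<Prod>j\<in>J. exp (x j))"
    using assms by (intro prod_mono) (smt (verit) exp_ge_add_one_self)
  then show ?thesis by (simp add: exp_sum True)
qed simp

text \<open>The event says that the largest eigenvalue is at least t. On it tr S^p is at least t^p
  for all p, so Markov's inequality works with truncated exponentials on both sides. The upper bound
  is independent of the truncation, which may therefore tend to infinity.\<close>

lemma avg_permutation_quad_tail_le: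
  fixes h :: "'d::finite \<Rightarrow> real ^ 'n::finite"
  assumes iso: "(\<Sum>k\<in>UNIV. outer (h k)) = (real CARD('d) * c) *\<^sub>R mat 1"
    and u: "\<And>j. 0 \<le> u j" "\<And>j k. u j * (h k \<bullet> h k) \<le> R" "(\<Sum>j\<in>UNIV. u j) = 1"
    and \<theta>: "0 \<le> \<theta>" and c: "0 \<le> c" and t: "0 \<le> t"
  shows "avg {\<pi>. \<pi> permutes UNIV}
      (\<lambda>\<pi>. of_bool (\<exists>x. norm x = 1 \<and> t \<le> x \<bullet> ((\<Sum>k\<in>UNIV. u (\<pi> k) *\<^sub>R outer (h k)) *v x)))
    \<le> real CARD('n) * exp (c * \<theta> * exp (\<theta> * R) - \<theta> * t)"
proof -
  let ?P = "{\<pi> :: 'd \<Rightarrow> 'd. \<pi> permutes UNIV}"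
  let ?S = "\<lambda>\<pi>. \<Sum>k\<in>UNIV. u (\<pi> k) *\<^sub>R outer (h k)"
  let ?bad = "\<lambda>\<pi>. of_bool (\<exists>x. norm x = 1 \<and> t \<le> x \<bullet> (?S \<pi> *v x)) :: real"
  define B where "B = real CARD('n) * exp (c * \<theta> * exp (\<theta> * R))"
  have upper: "avg ?P (\<lambda>\<pi>. trace_exp_partial P \<theta> (?S \<pi>)) \<le> B" for P
  proof -
    have "avg ?P (\<lambda>\<pi>. trace_exp_partial P \<theta> (?S \<pi>))
      \<le> avg UNIV (\<lambda>K. trace_exp_partial P \<theta> (\<Sum>j\<in>UNIV. u j *\<^sub>R outer (h (K j))))"
    \<comment> \<open>Traces of powers are shown to be convex on the psd cone, which contains every
      nonnegative combination of the outer products.\<close>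
    proof (rule avg_permutation_le_avg_function [where Q = psd])
      show "psd (\<Sum>k\<in>UNIV. v k *\<^sub>R outer (h (\<sigma> k)))" if "\<forall>k. 0 \<le> v k" for v \<sigma>
        using that by (intro psd_sum psd_scaleR psd_outer) auto
    qed (auto intro: trace_exp_partial_convex \<theta> u)
    also have "\<dots> \<le> real CARD('n) * (\<Prod>j\<in>UNIV. 1 + u j * c * \<theta> * exp (\<theta> * R))"
      using avg_trace_exp_partial_le [OF iso u(1) u(2) \<theta> c finite [of UNIV] order_refl, of P] by simp
    also have "\<dots> \<le> real CARD('n) * exp (\<Sum>j\<in>UNIV. u j * c * \<theta> * exp (\<theta> * R))"
    proof (intro mult_left_mono prod_one_plus_le_exp)
      fix j
      have "0 \<le> u j * c * \<theta> * exp (\<theta> * R)" using u c \<theta> by simp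
      then show "-1 \<le> u j * c * \<theta> * exp (\<theta> * R)" by linarith
    qed simp
    also have "(\<Sum>j\<in>UNIV. u j * c * \<theta> * exp (\<theta> * R)) = c * \<theta> * exp (\<theta> * R)"
      by (simp add: sum_distrib_right [symmetric] u)
    finally show ?thesis by (simp add: B_def)
  qed
  have partial: "(\<Sum>p\<le>P. (\<theta> * t) ^ p / fact p) * avg ?P ?bad \<le> B" for P
  proof -
    have "(\<Sum>p\<le>P. (\<theta> * t) ^ p / fact p) * avg ?P ?bad
       = avg ?P (\<lambda>\<pi>. (\<Sum>p\<le>P. (\<theta> * t) ^ p / fact p) * ?bad \<pi>)"
      by (simp add: avg_cmult)
    also have "\<dots> \<le> avg ?P (\<lambda>\<pi>. trace_exp_partial P \<theta> (?S \<pi>))"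
    proof (rule avg_mono)
      fix \<pi>
      have S: "psd (?S \<pi>)" by (intro psd_sum psd_scaleR psd_outer u)
      show "(\<Sum>p\<le>P. (\<theta> * t) ^ p / fact p) * ?bad \<pi> \<le> trace_exp_partial P \<theta> (?S \<pi>)"
      proof (cases "\<exists>x. norm x = 1 \<and> t \<le> x \<bullet> (?S \<pi> *v x)")
        case False
        have "0 \<le> trace_exp_partial P \<theta> (?S \<pi>)"
          unfolding trace_exp_partial_def
          by (intro sum_nonneg mult_nonneg_nonneg trace_psd psd_mpow S) (use \<theta> in auto)
        then show ?thesis by (simp only: False of_bool_eq mult_zero_right)
      next
        case True
        then obtain x where x: "norm x = 1" "t \<le> x \<bullet> (?S \<pi> *v x)" by blast
        have "t ^ p \<le> trace (mpow (?S \<pi>) p)" for p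
          using power_mono [OF x(2) t, of p] psd_quad_power_le_trace [OF S x(1), of p] by linarith
        then have "(\<Sum>p\<le>P. \<theta> ^ p / fact p * t ^ p) \<le> trace_exp_partial P \<theta> (?S \<pi>)"
          unfolding trace_exp_partial_def using \<theta> by (intro sum_mono mult_left_mono) auto
        then show ?thesis by (simp only: True of_bool_eq mult_1_right) (simp add: power_mult_distrib)
      qed
    qed
    finally show ?thesis using upper [of P] by linarith
  qed
  have "(\<lambda>P. \<Sum>p\<le>P. (\<theta> * t) ^ p / fact p) \<longlonglongrightarrow> exp (\<theta> * t)"
    using exp_converges [of "\<theta> * t"] by (simp add: sums_def_le field_simps)
  then have "(\<lambda>P. (\<Sum>p\<le>P. (\<theta> * t) ^ p / fact p) * avg ?P ?bad) \<longlonglongrightarrow> exp (\<theta> * t) * avg ?P ?bad"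
    by (intro tendsto_mult tendsto_const)
  then have "exp (\<theta> * t) * avg ?P ?bad \<le> B"
    by (rule LIMSEQ_le_const2) (use partial in auto)
  then show ?thesis
    by (simp add: B_def exp_diff field_simps)
qed

section \<open>Exponential moments of permuted sums and of Rademacher chaos\<close>

lemma exp_le_quadratic:
  assumes "\<bar>x\<bar> \<le> (1 :: real)"
  shows "exp x \<le> 1 + x + x\<^sup>2"
proof (cases "0 \<le> x")
  case True
  then show ?thesis using assms by (intro exp_bound) auto
next
  case False
  define y where "y = - x"
  have y: "0 < y" "y \<le> 1" using False assms by (auto simp: y_def)
  \<comment> \<open>The product is 1 + y^3.\<close>
  have "1 \<le> (1 - y + y\<^sup>2) * (1 + y)"
    using y by (simp add: power2_eq_square algebra_simps)
  also have "\<dots> \<le> (1 - y + y\<^sup>2) * exp y"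
  proof (intro mult_left_mono)
    show "0 \<le> 1 - y + y\<^sup>2" using y by (smt (verit) zero_le_power2)
  qed (use exp_ge_add_one_self in auto)
  finally have "exp (- y) \<le> 1 - y + y\<^sup>2"
    by (simp add: exp_minus field_simps)
  then show ?thesis by (simp add: y_def)
qed

text \<open>The two power series are compared term by term, using 2^n n! \<le> (2n)!.\<close>

lemma cosh_le_exp_half_square: "cosh x \<le> exp (x\<^sup>2 / 2 :: real)"
proof (rule sums_le)
  have fact_le: "2 ^ n * fact n \<le> (fact (2 * n) :: real)" for n
  proof (induction n)
    case (Suc n)
    have "2 ^ Suc n * fact (Suc n) = (2 * real (Suc n)) * (2 ^ n * fact n :: real)"
      by (simp add: algebra_simps)
    also have "\<dots> \<le> (2 * real (Suc n)) * (fact (2 * n))"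
      using Suc by (intro mult_left_mono) auto
    also have "\<dots> \<le> (2 * real (Suc n)) * (real (Suc (2 * n)) * fact (2 * n))"
      by (intro mult_left_mono) auto
    also have "\<dots> = fact (2 * Suc n)"
      by (simp add: algebra_simps)
    finally show ?case .
  qed simp
  show "x ^ (2 * n) / fact (2 * n) \<le> (x\<^sup>2 / 2) ^ n / fact n" for n
  proof -
    have "(x\<^sup>2) ^ n / fact (2 * n) \<le> (x\<^sup>2) ^ n / (2 ^ n * fact n)"
      using fact_le by (intro divide_left_mono) auto
    then show ?thesis by (simp add: power_mult power_divide)
  qed
  have "(\<lambda>n. if even n then x ^ n /\<^sub>R fact n else 0) sums cosh x"
    by (rule cosh_converges)
  then have "(\<lambda>n. (\<lambda>n. if even n then x ^ n /\<^sub>R fact n else 0) (2 * n)) sums cosh x"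
    by (subst sums_mono_reindex [of "\<lambda>n. 2 * n"]) (auto simp: strict_mono_def elim!: evenE)
  then show "(\<lambda>n. x ^ (2 * n) / fact (2 * n)) sums cosh x"
    by (simp add: field_simps)
  show "(\<lambda>n. (x\<^sup>2 / 2) ^ n / fact n) sums exp (x\<^sup>2 / 2)"
    using exp_converges [of "x\<^sup>2 / 2"] by (simp add: field_simps)
qed

text \<open>After the comparison the exponential factorizes. In each factor the square of a summand
  is at most R times the summand itself, so the second moment is controlled by the mean; hence the
  variance proxy R in the exponent.\<close>

lemma avg_permutation_exp_le:
  fixes c u :: "'d::finite \<Rightarrow> real"
  assumes c: "\<And>k. 0 \<le> c k" "avg UNIV c = 1"
    and u: "\<And>j. 0 \<le> u j" "(\<Sum>j\<in>UNIV. u j) = 1" and R: "\<And>j k. u j * c k \<le> R"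
    and \<theta>: "\<bar>\<theta>\<bar> * R \<le> 1"
  shows "avg {\<pi>. \<pi> permutes UNIV} (\<lambda>\<pi>. exp (\<theta> * (\<Sum>k\<in>UNIV. u (\<pi> k) * c k))) \<le> exp (\<theta> + \<theta>\<^sup>2 * R)"
proof -
  have "avg {\<pi>. \<pi> permutes UNIV} (\<lambda>\<pi>. exp (\<theta> * (\<Sum>k\<in>UNIV. u (\<pi> k) *\<^sub>R c k)))
    \<le> avg UNIV (\<lambda>K. exp (\<theta> * (\<Sum>j\<in>UNIV. u j *\<^sub>R c (K j))))"
  proof (rule avg_permutation_le_avg_function [where Q = "\<lambda>_. True"])
    fix a b t :: real
    assume t: "0 \<le> t" "t \<le> 1"
    have "exp (t * (\<theta> * a) + (1 - t) * (\<theta> * b)) \<le> t * exp (\<theta> * a) + (1 - t) * exp (\<theta> * b)"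
      using convex_onD [OF exp_convex, of t "\<theta> * b" "\<theta> * a"] t by (simp add: add.commute)
    then show "exp (\<theta> * (t *\<^sub>R a + (1 - t) *\<^sub>R b)) \<le> t * exp (\<theta> * a) + (1 - t) * exp (\<theta> * b)"
      by (simp add: algebra_simps)
  qed (use u in auto)
  also have "\<dots> = avg UNIV (\<lambda>K. \<Prod>j\<in>UNIV. exp (\<theta> * (u j * c (K j))))"
    by (simp add: sum_distrib_left exp_sum)
  also have "\<dots> = (\<Prod>j\<in>UNIV. avg UNIV (\<lambda>k. exp (\<theta> * (u j * c k))))"
    by (rule avg_prod_fun) simp
  also have "\<dots> \<le> (\<Prod>j\<in>UNIV. exp (\<theta> * u j + \<theta>\<^sup>2 * R * u j))"
  proof (intro prod_mono conjI)
    fix j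
    show "0 \<le> avg UNIV (\<lambda>k. exp (\<theta> * (u j * c k)))" by (intro avg_nonneg) simp
    have "avg UNIV (\<lambda>k. exp (\<theta> * (u j * c k))) \<le> avg UNIV (\<lambda>k. 1 + (\<theta> * u j + \<theta>\<^sup>2 * R * u j) * c k)"
    proof (rule avg_mono)
      fix k
      have 0: "0 \<le> u j * c k" using u c by simp
      have "\<bar>\<theta> * (u j * c k)\<bar> = \<bar>\<theta>\<bar> * (u j * c k)" by (subst abs_mult) (simp only: abs_of_nonneg [OF 0])
      also have "\<dots> \<le> \<bar>\<theta>\<bar> * R" using R by (intro mult_left_mono) auto
      finally have "exp (\<theta> * (u j * c k)) \<le> 1 + \<theta> * (u j * c k) + (\<theta> * (u j * c k))\<^sup>2"
        using \<theta> by (intro exp_le_quadratic) linarith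
      also have "(\<theta> * (u j * c k))\<^sup>2 = \<theta>\<^sup>2 * ((u j * c k) * (u j * c k))"
        by (simp add: power2_eq_square)
      also have "\<dots> \<le> \<theta>\<^sup>2 * (R * (u j * c k))"
        using R 0 by (intro mult_left_mono mult_right_mono) auto
      finally show "exp (\<theta> * (u j * c k)) \<le> 1 + (\<theta> * u j + \<theta>\<^sup>2 * R * u j) * c k"
        by (simp add: algebra_simps)
    qed
    also have "\<dots> = 1 + (\<theta> * u j + \<theta>\<^sup>2 * R * u j)"
      by (simp add: avg_add avg_cmult avg_const c)
    also have "\<dots> \<le> exp (\<theta> * u j + \<theta>\<^sup>2 * R * u j)"
      by (rule exp_ge_add_one_self)
    finally show "avg UNIV (\<lambda>k. exp (\<theta> * (u j * c k))) \<le> exp (\<theta> * u j + \<theta>\<^sup>2 * R * u j)" .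
  qed
  also have "\<dots> = exp (\<Sum>j\<in>UNIV. (\<theta> + \<theta>\<^sup>2 * R) * u j)"
    by (simp add: exp_sum algebra_simps)
  also have "\<dots> = exp (\<theta> + \<theta>\<^sup>2 * R)"
    by (simp add: sum_distrib_left [symmetric] u)
  finally show ?thesis by simp
qed

section \<open>Averages over sign vectors\<close>

lemma sign_vectors_square: "\<xi> \<in> sign_vectors \<Longrightarrow> (\<xi> $ i)\<^sup>2 = 1"
  by (auto simp: sign_vectors_def power2_eq_1_iff)

definition flip :: "'d \<Rightarrow> real ^ 'd::finite \<Rightarrow> real ^ 'd" where
  "flip i \<xi> = (\<chi> j. if j = i then - \<xi> $ j else \<xi> $ j)"

lemma flip_nth: "flip i \<xi> $ j = (if j = i then - \<xi> $ j else \<xi> $ j)"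
  by (simp add: flip_def)

text \<open>Conditioning on all signs but one, written as pairing each vector with its flip, so that
  everything remains a function of the whole sign vector.\<close>

lemma avg_flip: "avg sign_vectors f = avg sign_vectors (\<lambda>\<xi>. (f \<xi> + f (flip i \<xi>)) / 2)"
proof -
  have "bij_betw (flip i) sign_vectors (sign_vectors :: (real ^ 'a) set)"
    by (rule bij_betw_byWitness [where f' = "flip i"])
      (auto simp: sign_vectors_def flip_nth vec_eq_iff minus_equation_iff, metis+)
  from avg_reindex [OF this, of f]
  have "avg sign_vectors f = (avg sign_vectors f + avg sign_vectors (\<lambda>\<xi>. f (flip i \<xi>))) / 2"
    by simp
  also have "\<dots> = avg sign_vectors (\<lambda>\<xi>. (f \<xi> + f (flip i \<xi>)) / 2)"
    using avg_cmult [of _ "1/2" "\<lambda>\<xi>. f \<xi> + f (flip i \<xi>)"] by (simp add: avg_add)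
  finally show ?thesis .
qed

lemma sign_cosh_le:
  assumes "\<xi> \<in> sign_vectors"
  shows "(exp (s * \<xi> $ i) + exp (- (s * \<xi> $ i))) / 2 \<le> exp (s\<^sup>2 / 2)"
proof -
  have "(s * \<xi> $ i)\<^sup>2 = s\<^sup>2" using sign_vectors_square [OF assms, of i] by (simp add: power_mult_distrib)
  then show ?thesis using cosh_le_exp_half_square [of "s * \<xi> $ i"] by (simp add: cosh_field_def)
qed

lemma rademacher_sum_exp_le:
  fixes a :: "'d::finite \<Rightarrow> real"
  assumes "finite J"
  shows "avg sign_vectors (\<lambda>\<xi>. exp (\<Sum>j\<in>J. a j * \<xi> $ j)) \<le> exp ((\<Sum>j\<in>J. (a j)\<^sup>2) / 2)"
  using assms
proof (induction J)
  case empty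
  show ?case by (simp add: avg_signs_const)
next
  case (insert i J)
  let ?s = "\<lambda>\<xi> :: real ^ 'd. \<Sum>j\<in>J. a j * \<xi> $ j"
  have "avg sign_vectors (\<lambda>\<xi>. exp (\<Sum>j\<in>insert i J. a j * \<xi> $ j))
    \<le> avg sign_vectors (\<lambda>\<xi>. exp ((a i)\<^sup>2 / 2) * exp (?s \<xi>))"
  proof (subst avg_flip [of _ i], rule avg_mono)
    fix \<xi> :: "real ^ 'd" assume \<xi>: "\<xi> \<in> sign_vectors"
    have "?s (flip i \<xi>) = ?s \<xi>"
      using insert.hyps by (intro sum.cong) (auto simp: flip_nth)
    then have "(exp (\<Sum>j\<in>insert i J. a j * \<xi> $ j) + exp (\<Sum>j\<in>insert i J. a j * flip i \<xi> $ j)) / 2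
        = (exp (a i * \<xi> $ i) + exp (- (a i * \<xi> $ i))) / 2 * exp (?s \<xi>)"
      using insert.hyps by (simp add: exp_add exp_diff exp_minus flip_nth [of i \<xi> i] field_simps)
    also have "\<dots> \<le> exp ((a i)\<^sup>2 / 2) * exp (?s \<xi>)"
      by (intro mult_right_mono sign_cosh_le \<xi>) simp
    finally show "(exp (\<Sum>j\<in>insert i J. a j * \<xi> $ j) + exp (\<Sum>j\<in>insert i J. a j * flip i \<xi> $ j)) / 2
      \<le> exp ((a i)\<^sup>2 / 2) * exp (?s \<xi>)" .
  qed
  also have "\<dots> \<le> exp ((a i)\<^sup>2 / 2) * exp ((\<Sum>j\<in>J. (a j)\<^sup>2) / 2)"
    unfolding avg_cmult using insert by (intro mult_left_mono) auto
  finally show ?case using insert.hyps by (simp add: exp_add [symmetric] add_divide_distrib)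
qed

section \<open>Exponential moments of quadratic chaos\<close>

lemma quad_form_insert:
  fixes A :: "'d \<Rightarrow> 'd \<Rightarrow> real"
  assumes "finite J" "x \<notin> J" "\<And>i j. A i j = A j i"
  shows "(\<Sum>i\<in>insert x J. \<Sum>j\<in>insert x J. A i j * z i * z j)
    = A x x * (z x)\<^sup>2 + 2 * z x * (\<Sum>i\<in>J. A x i * z i) + (\<Sum>i\<in>J. \<Sum>j\<in>J. A i j * z i * z j)"
proof -
  have "(\<Sum>i\<in>J. A i x * z i * z x) = z x * (\<Sum>i\<in>J. A x i * z i)"
    by (subst sum_distrib_left, rule sum.cong) (use assms(3) in \<open>simp_all add: mult_ac\<close>)
  moreover have "(\<Sum>i\<in>J. A x i * z x * z i) = z x * (\<Sum>i\<in>J. A x i * z i)"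
    by (simp add: sum_distrib_left mult_ac)
  ultimately show ?thesis
    using assms(1,2) by (simp add: sum.distrib power2_eq_square)
qed

text \<open>Eliminating one sign replaces the coefficient matrix by its Schur complement, up to a smaller
  rank-one term. This keeps the bound on the largest eigenvalue and controls trace and Frobenius
  norm, so no Gaussian comparison or decoupling is needed.\<close>

lemma rademacher_chaos_exp_le:
  fixes A :: "'d::finite \<Rightarrow> 'd \<Rightarrow> real"
  assumes "finite J" and "\<And>i j. A i j = A j i" and "\<And>i. 0 \<le> A i i"
    and "\<And>z. (\<Sum>i\<in>J. \<Sum>j\<in>J. A i j * z i * z j) \<le> \<tau> * (\<Sum>i\<in>J. (z i)\<^sup>2)"
    and \<tau>: "0 \<le> \<tau>" "\<tau> < 1"
  shows "avg sign_vectors (\<lambda>\<xi>. exp ((\<Sum>i\<in>J. \<Sum>j\<in>J. A i j * \<xi> $ i * \<xi> $ j) / 2))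
    \<le> exp (((\<Sum>i\<in>J. A i i) + (\<Sum>i\<in>J. \<Sum>j\<in>J. (A i j)\<^sup>2) / (2 * (1 - \<tau>))) / 2)"
  using assms(1-4)
proof (induction J arbitrary: A)
  case empty
  show ?case by (simp add: avg_signs_const)
next
  case (insert x J)
  note sym = insert.prems(1) and diag = insert.prems(2) and top = insert.prems(3)
  define b where "b i = A x i" for i
  \<comment> \<open>With the other signs fixed, the sign at x multiplies s, the inner product of b
    with them. Bounding cosh s by exp(s^2/2) adds b b^T to the remaining matrix.\<close>
  define A' where "A' i j = A i j + b i * b j" for i j
  define B where "B = (\<Sum>i\<in>J. (b i)\<^sup>2)"
  define K where "K = 1 / (2 * (1 - \<tau>))"
  have K: "0 < K" "2 * (1 - \<tau>) * K = 1" using \<tau> by (auto simp: K_def)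
  let ?s = "\<lambda>z. \<Sum>i\<in>J. b i * z i"
  let ?q = "\<lambda>A z. \<Sum>i\<in>J. \<Sum>j\<in>J. A i j * z i * z j :: real"
  have q': "?q A' z = ?q A z + (?s z)\<^sup>2" for z
    by (simp add: A'_def power2_eq_square sum_product sum.distrib [symmetric] algebra_simps)
  have top': "?q A' z \<le> \<tau> * (\<Sum>i\<in>J. (z i)\<^sup>2)" for z
  proof -
    \<comment> \<open>The entry s(z) at x gains 2 s(z)^2 from the cross terms and costs at most
      \<tau> s(z)^2 \<le> s(z)^2 on the right. One s(z)^2 is left over, exactly the form of b b^T,
      so the bound \<tau> persists.\<close>
    define w where "w = z(x := ?s z)"
    have wJ: "w i = z i" if "i \<in> J" for i using that insert.hyps by (auto simp: w_def)
    have wx: "w x = ?s z" by (simp add: w_def)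
    have "A x x * (?s z)\<^sup>2 + 2 * ?s z * ?s z + ?q A z = (\<Sum>i\<in>insert x J. \<Sum>j\<in>insert x J. A i j * w i * w j)"
      unfolding quad_form_insert [OF insert.hyps sym] by (simp add: wx wJ b_def)
    also have "\<dots> \<le> \<tau> * (\<Sum>i\<in>insert x J. (w i)\<^sup>2)" by (rule top)
    also have "\<dots> = \<tau> * (?s z)\<^sup>2 + \<tau> * (\<Sum>i\<in>J. (z i)\<^sup>2)"
      using insert.hyps by (simp add: wx wJ algebra_simps)
    also have "\<dots> \<le> (?s z)\<^sup>2 + \<tau> * (\<Sum>i\<in>J. (z i)\<^sup>2)"
      using \<tau> by (simp add: mult_left_le_one_le)
    finally have "A x x * (?s z)\<^sup>2 + 2 * (?s z)\<^sup>2 + ?q A z \<le> (?s z)\<^sup>2 + \<tau> * (\<Sum>i\<in>J. (z i)\<^sup>2)"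
      by (simp only: power2_eq_square mult.assoc)
    then show ?thesis
      using mult_nonneg_nonneg [OF diag [of x] zero_le_power2 [of "?s z"]]
      unfolding q' by linarith
  qed
  have IH: "avg sign_vectors (\<lambda>\<xi>. exp (?q A' (\<lambda>i. \<xi> $ i) / 2))
    \<le> exp (((\<Sum>i\<in>J. A' i i) + K * (\<Sum>i\<in>J. \<Sum>j\<in>J. (A' i j)\<^sup>2)) / 2)"
    unfolding K_def using insert.IH [of A'] top'
    by (simp add: A'_def sym mult.commute diag)
  have "avg sign_vectors (\<lambda>\<xi>. exp ((\<Sum>i\<in>insert x J. \<Sum>j\<in>insert x J. A i j * \<xi> $ i * \<xi> $ j) / 2))
     \<le> avg sign_vectors (\<lambda>\<xi>. exp (A x x / 2) * exp (?q A' (\<lambda>i. \<xi> $ i) / 2))"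
  proof (subst avg_flip [of _ x], rule avg_mono)
    fix \<xi> :: "real ^ 'd" assume \<xi>: "\<xi> \<in> sign_vectors"
    define s q where "s = ?s (\<lambda>i. \<xi> $ i)" and "q = ?q A (\<lambda>i. \<xi> $ i)"
    have J1: "?s (\<lambda>i. flip x \<xi> $ i) = s"
      unfolding s_def using insert.hyps by (intro sum.cong) (auto simp: flip_nth)
    have J2: "?q A (\<lambda>i. flip x \<xi> $ i) = q"
      unfolding q_def using insert.hyps by (intro sum.cong) (auto simp: flip_nth)
    have f1: "(\<Sum>i\<in>insert x J. \<Sum>j\<in>insert x J. A i j * \<xi> $ i * \<xi> $ j) / 2 = A x x / 2 + s * \<xi> $ x + q / 2"
      unfolding quad_form_insert [OF insert.hyps sym, where z = "\<lambda>i. \<xi> $ i"] b_def [symmetric] s_def [symmetric] q_def [symmetric]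
      by (simp add: sign_vectors_square [OF \<xi>] add_divide_distrib)
    have f2: "(\<Sum>i\<in>insert x J. \<Sum>j\<in>insert x J. A i j * flip x \<xi> $ i * flip x \<xi> $ j) / 2
        = A x x / 2 + - (s * \<xi> $ x) + q / 2"
      unfolding quad_form_insert [OF insert.hyps sym, where z = "\<lambda>i. flip x \<xi> $ i"] b_def [symmetric] J1 J2
      by (simp add: flip_nth sign_vectors_square [OF \<xi>] add_divide_distrib diff_divide_distrib)
    have "(exp (A x x / 2 + s * \<xi> $ x + q / 2) + exp (A x x / 2 + - (s * \<xi> $ x) + q / 2)) / 2
       = (exp (A x x / 2) * exp (q / 2)) * ((exp (s * \<xi> $ x) + exp (- (s * \<xi> $ x))) / 2)"
      by (simp only: exp_add) (simp add: algebra_simps add_divide_distrib)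
    also have "\<dots> \<le> (exp (A x x / 2) * exp (q / 2)) * exp (s\<^sup>2 / 2)"
      by (intro mult_left_mono sign_cosh_le \<xi>) simp
    also have "\<dots> = exp (A x x / 2) * exp (?q A' (\<lambda>i. \<xi> $ i) / 2)"
      unfolding q' s_def [symmetric] q_def [symmetric]
      by (simp add: exp_add [symmetric] add_divide_distrib)
    finally show "(exp ((\<Sum>i\<in>insert x J. \<Sum>j\<in>insert x J. A i j * \<xi> $ i * \<xi> $ j) / 2)
        + exp ((\<Sum>i\<in>insert x J. \<Sum>j\<in>insert x J. A i j * flip x \<xi> $ i * flip x \<xi> $ j) / 2)) / 2
      \<le> exp (A x x / 2) * exp (?q A' (\<lambda>i. \<xi> $ i) / 2)"
      unfolding f1 f2 .
  qed
  also have "\<dots> \<le> exp (A x x / 2) * exp (((\<Sum>i\<in>J. A' i i) + K * (\<Sum>i\<in>J. \<Sum>j\<in>J. (A' i j)\<^sup>2)) / 2)"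
    unfolding avg_cmult by (intro mult_left_mono IH) simp
  also have "\<dots> = exp ((A x x + (\<Sum>i\<in>J. A' i i) + K * (\<Sum>i\<in>J. \<Sum>j\<in>J. (A' i j)\<^sup>2)) / 2)"
    by (simp add: exp_add [symmetric] add_divide_distrib)
  also have "\<dots> \<le> exp (((\<Sum>i\<in>insert x J. A i i)
      + (\<Sum>i\<in>insert x J. \<Sum>j\<in>insert x J. (A i j)\<^sup>2) / (2 * (1 - \<tau>))) / 2)"
  proof -
    let ?F = "\<lambda>A. \<Sum>i\<in>J. \<Sum>j\<in>J. (A i j)\<^sup>2 :: real"
    have sb: "?s b = B" by (simp add: B_def power2_eq_square)
    have Bsq: "(\<Sum>i\<in>J. \<Sum>j\<in>J. (b i * b j)\<^sup>2) = B\<^sup>2"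
      by (simp add: B_def power2_eq_square [of "sum _ _"] sum_product power_mult_distrib)
    have F': "?F A' = ?F A + 2 * ?q A b + B\<^sup>2"
      unfolding Bsq [symmetric]
      by (simp add: A'_def power2_sum sum.distrib sum_distrib_left mult_ac)
    have F: "(\<Sum>i\<in>insert x J. \<Sum>j\<in>insert x J. (A i j)\<^sup>2) = (A x x)\<^sup>2 + 2 * B + ?F A"
    proof -
      have "(\<Sum>i\<in>J. (A i x)\<^sup>2) = B"
        unfolding B_def b_def by (intro sum.cong refl) (metis sym)
      moreover have "(\<Sum>i\<in>J. (A x i)\<^sup>2) = B" by (simp add: B_def b_def)
      ultimately show ?thesis using insert.hyps by (simp add: sum.distrib)
    qed
    have tr: "(\<Sum>i\<in>J. A' i i) = (\<Sum>i\<in>J. A i i) + B"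
      by (simp add: A'_def B_def sum.distrib power2_eq_square)
    \<comment> \<open>The new form is tested at b itself. The elimination adds B to the trace and 2
      q(b) + B^2 to the squared Frobenius norm, which has lost 2 B from row and column x. The weight
      K = 1/(2(1 - \<tau>)) is the one that balances these changes.\<close>
    have "?q A b + B\<^sup>2 \<le> \<tau> * B"
      using top' [of b] by (simp add: q' sb) (simp add: B_def)
    moreover have "2 * (1 - \<tau>) * B = 2 * B - 2 * (\<tau> * B)" by (simp add: algebra_simps)
    ultimately have "2 * (1 - \<tau>) * B + (2 * ?q A b + B\<^sup>2) \<le> (A x x)\<^sup>2 + 2 * B"
      using zero_le_power2 [of B] zero_le_power2 [of "A x x"] by linarith
    then have "K * (2 * (1 - \<tau>) * B + (2 * ?q A b + B\<^sup>2)) \<le> K * ((A x x)\<^sup>2 + 2 * B)"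
      using K by (intro mult_left_mono) auto
    then have "K * (2 * (1 - \<tau>) * B) + K * (2 * ?q A b + B\<^sup>2) \<le> K * ((A x x)\<^sup>2 + 2 * B)"
      by (simp only: distrib_left)
    moreover have "K * (2 * (1 - \<tau>) * B) = B"
      using K by (simp add: mult.assoc [symmetric] mult.commute [of K])
    moreover have "K * ?F A' = K * ?F A + K * (2 * ?q A b + B\<^sup>2)"
      unfolding F' by (simp only: distrib_left add.assoc)
    moreover have "K * ((A x x)\<^sup>2 + 2 * B + ?F A) = K * ((A x x)\<^sup>2 + 2 * B) + K * ?F A"
      by (simp only: distrib_left)
    ultimately have "B + K * ?F A' \<le> K * ((A x x)\<^sup>2 + 2 * B + ?F A)"
      by linarith
    then show ?thesis
      unfolding F tr exp_le_cancel_iff using insert.hyps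
      by (intro divide_right_mono) (simp_all add: K_def)
  qed
  finally show ?case .
qed

section \<open>Concentration of the norm of a Rademacher vector sum\<close>

lemma norm_sum_scaled_le_dual:
  fixes b :: "'d::finite \<Rightarrow> 'a::real_inner"
  assumes "\<And>x. (\<Sum>k\<in>UNIV. (x \<bullet> b k)\<^sup>2) \<le> \<rho> * (x \<bullet> x)" and "0 \<le> \<rho>"
  shows "(norm (\<Sum>k\<in>UNIV. z k *\<^sub>R b k))\<^sup>2 \<le> \<rho> * (\<Sum>k\<in>UNIV. (z k)\<^sup>2)"
proof -
  \<comment> \<open>An operator and its transpose have the same norm: the hypothesis is tested at
    the image p itself, and one factor p \<bullet> p cancels.\<close>
  define p where "p = (\<Sum>k\<in>UNIV. z k *\<^sub>R b k)"
  have pp: "p \<bullet> p = (\<Sum>k\<in>UNIV. z k * (p \<bullet> b k))"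
    by (subst (2) p_def) (simp add: inner_sum_right)
  have "(p \<bullet> p)\<^sup>2 \<le> (\<Sum>k\<in>UNIV. (z k)\<^sup>2) * (\<Sum>k\<in>UNIV. (p \<bullet> b k)\<^sup>2)"
    unfolding pp by (rule Cauchy_Schwarz_ineq_sum)
  also have "\<dots> \<le> (\<Sum>k\<in>UNIV. (z k)\<^sup>2) * (\<rho> * (p \<bullet> p))"
    by (intro mult_left_mono assms sum_nonneg) auto
  finally have le: "(p \<bullet> p) * (p \<bullet> p) \<le> (\<rho> * (\<Sum>k\<in>UNIV. (z k)\<^sup>2)) * (p \<bullet> p)"
    by (simp add: power2_eq_square mult_ac)
  have "p \<bullet> p \<le> \<rho> * (\<Sum>k\<in>UNIV. (z k)\<^sup>2)"
  proof (cases "p = 0")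
    case False
    then show ?thesis using le by (simp add: mult_le_cancel_right)
  next
    case True
    then show ?thesis using assms(2) by (simp add: sum_nonneg)
  qed
  then show ?thesis by (simp add: p_def power2_norm_eq_inner)
qed

text \<open>The squared norm is a chaos with the Gram matrix of the b_k, whose top eigenvalue is at
  most \<rho>, whose trace is F and whose squared Frobenius norm is at most \<rho> F.\<close>

lemma rademacher_vector_norm_exp_le:
  fixes b :: "'d::finite \<Rightarrow> 'a::real_inner"
  assumes op: "\<And>x. (\<Sum>k\<in>UNIV. (x \<bullet> b k)\<^sup>2) \<le> \<rho> * (x \<bullet> x)"
    and F: "F = (\<Sum>k\<in>UNIV. b k \<bullet> b k)" and \<rho>: "0 \<le> \<rho>" and \<theta>: "0 \<le> \<theta>" "4 * \<theta> * \<rho> \<le> 1"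
  shows "avg sign_vectors (\<lambda>\<xi>. exp (\<theta> * ((norm (\<Sum>k\<in>UNIV. \<xi> $ k *\<^sub>R b k))\<^sup>2 - F))) \<le> exp (2 * \<theta>\<^sup>2 * \<rho> * F)"
    and "avg sign_vectors (\<lambda>\<xi>. exp (- (\<theta> * ((norm (\<Sum>k\<in>UNIV. \<xi> $ k *\<^sub>R b k))\<^sup>2 - F)))) \<le> exp (2 * \<theta>\<^sup>2 * \<rho> * F)"
proof -
  let ?N = "\<lambda>z. (norm (\<Sum>k\<in>UNIV. z k *\<^sub>R b k))\<^sup>2"
  define \<tau> where "\<tau> = 2 * \<theta> * \<rho>"
  \<comment> \<open>With \<tau> at most 1/2 the denominator 2(1 - \<tau>) of the chaos bound is at
    least 1.\<close>
  have \<tau>: "0 \<le> \<tau>" "\<tau> \<le> 1 / 2" using \<rho> \<theta> by (auto simp: \<tau>_def)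
  have F0: "0 \<le> F" by (simp add: F sum_nonneg)
  have N: "?N z = (\<Sum>i\<in>UNIV. \<Sum>j\<in>UNIV. (b i \<bullet> b j) * z i * z j)" for z
    by (simp add: power2_norm_eq_inner inner_sum_left inner_sum_right sum_distrib_left mult_ac
        inner_commute)
  have frob: "(\<Sum>i\<in>UNIV. \<Sum>j\<in>UNIV. (b i \<bullet> b j)\<^sup>2) \<le> \<rho> * F"
    unfolding F sum_distrib_left by (intro sum_mono op)
  have bound: "(4 * \<theta>\<^sup>2 * (\<rho> * F)) / (2 * (1 - \<tau>)) \<le> 4 * \<theta>\<^sup>2 * \<rho> * F"
  proof -
    have "(4 * \<theta>\<^sup>2 * (\<rho> * F)) / (2 * (1 - \<tau>)) \<le> (4 * \<theta>\<^sup>2 * (\<rho> * F)) / 1"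
      using \<tau> F0 \<rho> by (intro divide_left_mono) auto
    then show ?thesis by simp
  qed
  have diag_le: "b i \<bullet> b i \<le> \<rho>" for i
  proof (cases "b i = 0")
    case False
    have "(b i \<bullet> b i)\<^sup>2 \<le> (\<Sum>k\<in>UNIV. (b i \<bullet> b k)\<^sup>2)"
      by (rule member_le_sum) auto
    also have "\<dots> \<le> \<rho> * (b i \<bullet> b i)" by (rule op)
    finally show ?thesis using False by (simp add: power2_eq_square mult_le_cancel_right)
  qed (use \<rho> in simp)
  show "avg sign_vectors (\<lambda>\<xi>. exp (\<theta> * (?N (\<lambda>k. \<xi> $ k) - F))) \<le> exp (2 * \<theta>\<^sup>2 * \<rho> * F)"
  proof -
    define A where "A i j = 2 * \<theta> * (b i \<bullet> b j)" for i j
    have q: "(\<Sum>i\<in>UNIV. \<Sum>j\<in>UNIV. A i j * z i * z j) = 2 * \<theta> * ?N z" for z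
      by (simp add: N A_def sum_distrib_left mult_ac)
    have "avg sign_vectors (\<lambda>\<xi>. exp ((\<Sum>i\<in>UNIV. \<Sum>j\<in>UNIV. A i j * \<xi> $ i * \<xi> $ j) / 2))
      \<le> exp (((\<Sum>i\<in>UNIV. A i i) + (\<Sum>i\<in>UNIV. \<Sum>j\<in>UNIV. (A i j)\<^sup>2) / (2 * (1 - \<tau>))) / 2)"
    proof (rule rademacher_chaos_exp_le)
      show "A i j = A j i" for i j by (simp add: A_def inner_commute)
      show "0 \<le> A i i" for i using \<theta> by (simp add: A_def)
      show "(\<Sum>i\<in>UNIV. \<Sum>j\<in>UNIV. A i j * z i * z j) \<le> \<tau> * (\<Sum>i\<in>UNIV. (z i)\<^sup>2)" for z
        unfolding q \<tau>_def using norm_sum_scaled_le_dual [OF op \<rho>, of z] \<theta>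
        by (simp add: mult.assoc mult_left_mono)
    qed (use \<tau> in auto)
    also have "\<dots> \<le> exp ((2 * \<theta> * F + 4 * \<theta>\<^sup>2 * \<rho> * F) / 2)"
    proof -
      have "(\<Sum>i\<in>UNIV. \<Sum>j\<in>UNIV. (A i j)\<^sup>2) = 4 * \<theta>\<^sup>2 * (\<Sum>i\<in>UNIV. \<Sum>j\<in>UNIV. (b i \<bullet> b j)\<^sup>2)"
        by (simp add: A_def power_mult_distrib sum_distrib_left)
      also have "\<dots> \<le> 4 * \<theta>\<^sup>2 * (\<rho> * F)" using frob by (intro mult_left_mono) auto
      finally have "(\<Sum>i\<in>UNIV. \<Sum>j\<in>UNIV. (A i j)\<^sup>2) / (2 * (1 - \<tau>)) \<le> 4 * \<theta>\<^sup>2 * (\<rho> * F) / (2 * (1 - \<tau>))"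
        using \<tau> by (intro divide_right_mono) auto
      also note bound
      finally have "(\<Sum>i\<in>UNIV. \<Sum>j\<in>UNIV. (A i j)\<^sup>2) / (2 * (1 - \<tau>)) \<le> 4 * \<theta>\<^sup>2 * \<rho> * F" .
      moreover have "(\<Sum>i\<in>UNIV. A i i) = 2 * \<theta> * F" by (simp add: A_def F sum_distrib_left)
      ultimately show ?thesis
        unfolding exp_le_cancel_iff by (intro divide_right_mono) simp_all
    qed
    finally have *: "avg sign_vectors (\<lambda>\<xi>. exp (\<theta> * ?N (\<lambda>k. \<xi> $ k))) \<le> exp (\<theta> * F + 2 * \<theta>\<^sup>2 * \<rho> * F)"
      unfolding q by (simp add: add_divide_distrib mult_ac)
    have "avg sign_vectors (\<lambda>\<xi>. exp (\<theta> * (?N (\<lambda>k. \<xi> $ k) - F)))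
       = avg sign_vectors (\<lambda>\<xi>. exp (- (\<theta> * F)) * exp (\<theta> * ?N (\<lambda>k. \<xi> $ k)))"
      by (simp add: exp_add [symmetric] right_diff_distrib)
    also have "\<dots> \<le> exp (- (\<theta> * F)) * exp (\<theta> * F + 2 * \<theta>\<^sup>2 * \<rho> * F)"
      unfolding avg_cmult using * by (intro mult_left_mono) auto
    finally show ?thesis by (simp add: exp_add [symmetric])
  qed
  show "avg sign_vectors (\<lambda>\<xi>. exp (- (\<theta> * (?N (\<lambda>k. \<xi> $ k) - F)))) \<le> exp (2 * \<theta>\<^sup>2 * \<rho> * F)"
  proof -
    \<comment> \<open>The negated Gram matrix would violate the requirement of a nonnegative
      diagonal. On sign vectors the diagonal part is the constant F, so it is deleted here and
      accounts for the centering. The top eigenvalue is then controlled by the largest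
      |b_i|^2.\<close>
    define A where "A i j = (if i = j then 0 else - (2 * \<theta>) * (b i \<bullet> b j))" for i j
    have q: "(\<Sum>i\<in>UNIV. \<Sum>j\<in>UNIV. A i j * z i * z j)
        = 2 * \<theta> * (\<Sum>i\<in>UNIV. (b i \<bullet> b i) * (z i)\<^sup>2) - 2 * \<theta> * ?N z" for z
    proof -
      have "(\<Sum>i\<in>UNIV. \<Sum>j\<in>UNIV. A i j * z i * z j)
        = (\<Sum>i\<in>UNIV. \<Sum>j\<in>UNIV. (if i = j then 2 * \<theta> * ((b i \<bullet> b i) * (z i)\<^sup>2) else 0)
            - 2 * \<theta> * ((b i \<bullet> b j) * z i * z j))"
        by (intro sum.cong refl) (auto simp: A_def power2_eq_square)
      also have "\<dots> = (\<Sum>i\<in>UNIV. 2 * \<theta> * ((b i \<bullet> b i) * (z i)\<^sup>2)) - 2 * \<theta> * ?N z"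
        unfolding N by (simp add: sum_subtractf sum_distrib_left)
      finally show ?thesis by (simp add: sum_distrib_left)
    qed
    have "avg sign_vectors (\<lambda>\<xi>. exp ((\<Sum>i\<in>UNIV. \<Sum>j\<in>UNIV. A i j * \<xi> $ i * \<xi> $ j) / 2))
      \<le> exp (((\<Sum>i\<in>UNIV. A i i) + (\<Sum>i\<in>UNIV. \<Sum>j\<in>UNIV. (A i j)\<^sup>2) / (2 * (1 - \<tau>))) / 2)"
    proof (rule rademacher_chaos_exp_le)
      show "A i j = A j i" for i j by (simp add: A_def inner_commute)
      show "0 \<le> A i i" for i by (simp add: A_def)
      show "(\<Sum>i\<in>UNIV. \<Sum>j\<in>UNIV. A i j * z i * z j) \<le> \<tau> * (\<Sum>i\<in>UNIV. (z i)\<^sup>2)" for z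
      proof -
        have "(\<Sum>i\<in>UNIV. (b i \<bullet> b i) * (z i)\<^sup>2) \<le> \<rho> * (\<Sum>i\<in>UNIV. (z i)\<^sup>2)"
          unfolding sum_distrib_left by (intro sum_mono mult_right_mono diag_le) auto
        then have "2 * \<theta> * (\<Sum>i\<in>UNIV. (b i \<bullet> b i) * (z i)\<^sup>2) \<le> 2 * \<theta> * (\<rho> * (\<Sum>i\<in>UNIV. (z i)\<^sup>2))"
          using \<theta> by (intro mult_left_mono) auto
        moreover have "0 \<le> 2 * \<theta> * ?N z" using \<theta> by simp
        ultimately show ?thesis unfolding q \<tau>_def by (simp add: mult.assoc)
      qed
    qed (use \<tau> in auto)
    also have "\<dots> \<le> exp ((4 * \<theta>\<^sup>2 * \<rho> * F) / 2)"
    proof -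
      have "(\<Sum>i\<in>UNIV. \<Sum>j\<in>UNIV. (A i j)\<^sup>2) \<le> (\<Sum>i\<in>UNIV. \<Sum>j\<in>UNIV. 4 * \<theta>\<^sup>2 * (b i \<bullet> b j)\<^sup>2)"
        by (intro sum_mono) (auto simp: A_def power_mult_distrib)
      also have "\<dots> = 4 * \<theta>\<^sup>2 * (\<Sum>i\<in>UNIV. \<Sum>j\<in>UNIV. (b i \<bullet> b j)\<^sup>2)"
        by (simp add: sum_distrib_left)
      also have "\<dots> \<le> 4 * \<theta>\<^sup>2 * (\<rho> * F)" using frob by (intro mult_left_mono) auto
      finally have "(\<Sum>i\<in>UNIV. \<Sum>j\<in>UNIV. (A i j)\<^sup>2) / (2 * (1 - \<tau>)) \<le> 4 * \<theta>\<^sup>2 * (\<rho> * F) / (2 * (1 - \<tau>))"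
        using \<tau> by (intro divide_right_mono) auto
      also note bound
      finally have "(\<Sum>i\<in>UNIV. \<Sum>j\<in>UNIV. (A i j)\<^sup>2) / (2 * (1 - \<tau>)) \<le> 4 * \<theta>\<^sup>2 * \<rho> * F" .
      moreover have "(\<Sum>i\<in>UNIV. A i i) = 0" by (simp add: A_def)
      ultimately show ?thesis
        unfolding exp_le_cancel_iff by (intro divide_right_mono) simp_all
    qed
    also have "avg sign_vectors (\<lambda>\<xi>. exp ((\<Sum>i\<in>UNIV. \<Sum>j\<in>UNIV. A i j * \<xi> $ i * \<xi> $ j) / 2))
      = avg sign_vectors (\<lambda>\<xi>. exp (- (\<theta> * (?N (\<lambda>k. \<xi> $ k) - F))))"
    proof (rule avg_cong)
      fix \<xi> :: "real ^ 'd" assume "\<xi> \<in> sign_vectors"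
      then have "(\<Sum>i\<in>UNIV. (b i \<bullet> b i) * (\<xi> $ i)\<^sup>2) = F"
        by (simp add: sign_vectors_square F)
      then show "exp ((\<Sum>i\<in>UNIV. \<Sum>j\<in>UNIV. A i j * \<xi> $ i * \<xi> $ j) / 2)
        = exp (- (\<theta> * (?N (\<lambda>k. \<xi> $ k) - F)))"
        unfolding q by (simp add: algebra_simps diff_divide_distrib)
    qed
    finally show ?thesis by (simp add: mult_ac)
  qed
qed

lemma of_bool_le_exp: "(P \<Longrightarrow> 0 \<le> x) \<Longrightarrow> of_bool P \<le> exp (x :: real)"
  by (cases P) auto

lemma rademacher_vector_norm_tail_le:
  fixes b :: "'d::finite \<Rightarrow> 'a::real_inner"
  assumes op: "\<And>x. (\<Sum>k\<in>UNIV. (x \<bullet> b k)\<^sup>2) \<le> 2 / m * (x \<bullet> x)"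
    and F: "\<bar>(\<Sum>k\<in>UNIV. b k \<bullet> b k) - 1\<bar> \<le> 1 / (2 * sqrt m)" and m: "1 \<le> m" and l: "1 \<le> l"
  shows "avg sign_vectors (\<lambda>\<xi>. of_bool (\<not> \<bar>norm (\<Sum>k\<in>UNIV. \<xi> $ k *\<^sub>R b k) - 1\<bar> \<le> 10 * sqrt (l / m)))
    \<le> 2 * exp (- l)"
proof -
  define F where "F = (\<Sum>k\<in>UNIV. b k \<bullet> b k)"
  define q where "q = sqrt (l / m)"
  have q: "0 < q" using m l by (simp add: q_def)
  have mq: "m * q\<^sup>2 = l" using m l by (simp add: q_def)
  have "1 / sqrt m \<le> q" using m l by (simp add: q_def real_sqrt_divide divide_right_mono)
  then have Fq: "\<bar>F - 1\<bar> \<le> q / 2" using F by (simp add: F_def)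
  have "1 / (2 * sqrt m) \<le> 1 / 2" using m by simp
  then have F32: "F \<le> 3 / 2" using F unfolding F_def [symmetric] by linarith
  define \<mu> where "\<mu> = min q 1"
  \<comment> \<open>Here 4 \<theta> (2/m) = \<mu>, so the cap \<mu> \<le> 1 is the condition of the
    moment bound. Below the cap \<theta> is proportional to q and the exponent has order m q^2 =
    l.\<close>
  define \<theta> where "\<theta> = m * \<mu> / 8"
  have \<mu>: "0 < \<mu>" "\<mu> \<le> 1" "\<mu> \<le> q" using q by (auto simp: \<mu>_def)
  have \<theta>: "0 \<le> \<theta>" "4 * \<theta> * (2 / m) \<le> 1" using m \<mu> by (auto simp: \<theta>_def)
  have e: "2 * \<theta>\<^sup>2 * (2 / m) * F \<le> 6 * m * \<mu>\<^sup>2 / 64"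
  proof -
    have "2 * \<theta>\<^sup>2 * (2 / m) * F \<le> 2 * \<theta>\<^sup>2 * (2 / m) * (3 / 2)"
      using m F32 by (intro mult_left_mono) auto
    also have "\<dots> = 6 * m * \<mu>\<^sup>2 / 64" using m by (simp add: \<theta>_def power2_eq_square field_simps)
    finally show ?thesis .
  qed
  let ?N = "\<lambda>\<xi> :: real ^ 'd. norm (\<Sum>k\<in>UNIV. \<xi> $ k *\<^sub>R b k)"
  have up: "avg sign_vectors (\<lambda>\<xi>. of_bool (1 + 10 * q < ?N \<xi>)) \<le> exp (- l)"
  proof -
    \<comment> \<open>Squaring 1 + 10 q gives an excess 20 q + 100 q^2, of which the error of F
      takes at most q/2.\<close>
    define s where "s = 19 * q + 100 * q\<^sup>2"
    have "avg sign_vectors (\<lambda>\<xi>. of_bool (1 + 10 * q < ?N \<xi>))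
      \<le> avg sign_vectors (\<lambda>\<xi>. exp (- (\<theta> * s)) * exp (\<theta> * ((?N \<xi>)\<^sup>2 - F)))"
      unfolding exp_add [symmetric]
    proof (intro avg_mono of_bool_le_exp)
      fix \<xi> assume "1 + 10 * q < ?N \<xi>"
      then have "(1 + 10 * q)\<^sup>2 \<le> (?N \<xi>)\<^sup>2" using q by (intro power_mono) auto
      moreover have "F \<le> 1 + q / 2" using Fq by linarith
      ultimately have "s \<le> (?N \<xi>)\<^sup>2 - F"
        using q by (simp add: s_def power2_eq_square algebra_simps)
      then show "0 \<le> - (\<theta> * s) + \<theta> * ((?N \<xi>)\<^sup>2 - F)" using \<theta> by (simp add: mult_left_mono)
    qed
    also have "\<dots> \<le> exp (- (\<theta> * s)) * exp (6 * m * \<mu>\<^sup>2 / 64)"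
      unfolding avg_cmult
      using rademacher_vector_norm_exp_le(1) [OF op F_def _ \<theta>] m e
      by (intro mult_left_mono) (auto intro: order_trans)
    also have "\<dots> \<le> exp (- l)"
    proof -
      have "6 * m * \<mu>\<^sup>2 / 64 + m * q\<^sup>2 \<le> \<theta> * s"
      \<comment> \<open>For q \<le> 1 the linear part of s suffices; once \<theta> is capped, the
        part 100 q^2 supplies the decay.\<close>
      proof (cases "q \<le> 1")
        case True
        then have "\<mu> = q" by (simp add: \<mu>_def)
        then have "\<theta> * s = m * q\<^sup>2 * (19 / 8) + m * q ^ 3 * (100 / 8)"
          by (simp add: \<theta>_def s_def power2_eq_square power3_eq_cube algebra_simps)
        moreover have "0 \<le> m * q ^ 3" "0 \<le> m * q\<^sup>2" using m q by auto
        ultimately show ?thesis using \<open>\<mu> = q\<close> by (simp add: field_simps)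
      next
        case False
        then have "\<mu> = 1" by (simp add: \<mu>_def)
        then have "\<theta> * s = m * q * (19 / 8) + m * q\<^sup>2 * (100 / 8)"
          by (simp add: \<theta>_def s_def power2_eq_square algebra_simps)
        moreover have "m \<le> m * q" "0 \<le> m * q\<^sup>2" using m False by auto
        ultimately show ?thesis unfolding \<open>\<mu> = 1\<close> power_one using m by linarith
      qed
      then show ?thesis by (simp add: exp_add [symmetric] mq)
    qed
    finally show ?thesis .
  qed
  have low: "avg sign_vectors (\<lambda>\<xi>. of_bool (?N \<xi> < 1 - 10 * q)) \<le> exp (- l)"
  \<comment> \<open>For q \<ge> 1/10 a norm cannot fall below 1 - 10 q. Otherwise the bad event
    forces the norm below 1, so its square is no larger than the norm.\<close>
  proof (cases "q < 1 / 10")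
    case False
    then have "\<not> ?N \<xi> < 1 - 10 * q" for \<xi>
      using norm_ge_zero [of "\<Sum>k\<in>UNIV. \<xi> $ k *\<^sub>R b k"] by linarith
    then show ?thesis by (simp add: avg_def)
  next
    case True
    define s where "s = 19 / 2 * q"
    have \<mu>q: "\<mu> = q" using True by (simp add: \<mu>_def)
    have "avg sign_vectors (\<lambda>\<xi>. of_bool (?N \<xi> < 1 - 10 * q))
      \<le> avg sign_vectors (\<lambda>\<xi>. exp (- (\<theta> * s)) * exp (- (\<theta> * ((?N \<xi>)\<^sup>2 - F))))"
      unfolding exp_add [symmetric]
    proof (intro avg_mono of_bool_le_exp)
      fix \<xi> assume N: "?N \<xi> < 1 - 10 * q"
      have "(?N \<xi>)\<^sup>2 \<le> ?N \<xi>"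
        unfolding power2_eq_square using N q by (intro mult_left_le_one_le) auto
      then have "s \<le> - ((?N \<xi>)\<^sup>2 - F)"
        using N abs_le_D2 [OF Fq] by (simp add: s_def)
      then have "\<theta> * s \<le> \<theta> * (- ((?N \<xi>)\<^sup>2 - F))" using \<theta> by (intro mult_left_mono) auto
      then show "0 \<le> - (\<theta> * s) + - (\<theta> * ((?N \<xi>)\<^sup>2 - F))" by (simp add: algebra_simps)
    qed
    also have "\<dots> \<le> exp (- (\<theta> * s)) * exp (6 * m * \<mu>\<^sup>2 / 64)"
      unfolding avg_cmult
      using rademacher_vector_norm_exp_le(2) [OF op F_def _ \<theta>] m e
      by (intro mult_left_mono) (auto intro: order_trans)
    also have "\<dots> \<le> exp (- l)"
    proof -
      have "\<theta> * s = m * q\<^sup>2 * (19 / 16)"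
        by (simp add: \<theta>_def s_def \<mu>q power2_eq_square algebra_simps)
      moreover have "0 \<le> m * q\<^sup>2" using m q by auto
      ultimately have "6 * m * \<mu>\<^sup>2 / 64 + m * q\<^sup>2 \<le> \<theta> * s" by (simp add: \<mu>q field_simps)
      then show ?thesis by (simp add: exp_add [symmetric] mq)
    qed
    finally show ?thesis .
  qed
  have "avg sign_vectors (\<lambda>\<xi>. of_bool (\<not> \<bar>?N \<xi> - 1\<bar> \<le> 10 * q))
    \<le> avg sign_vectors (\<lambda>\<xi>. of_bool (1 + 10 * q < ?N \<xi>) + of_bool (?N \<xi> < 1 - 10 * q))"
    by (intro avg_mono) auto
  also have "\<dots> \<le> 2 * exp (- l)" unfolding avg_add using up low by simp
  finally show ?thesis by (simp add: q_def)
qed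

section \<open>Tail bounds\<close>

lemma rademacher_sum_tail_le:
  fixes a :: "'d::finite \<Rightarrow> real"
  assumes \<sigma>: "(\<Sum>j\<in>UNIV. (a j)\<^sup>2) \<le> \<sigma>" "0 < \<sigma>" and L: "0 \<le> L"
  shows "avg sign_vectors (\<lambda>\<xi>. of_bool (2 * \<sigma> * L < (\<Sum>j\<in>UNIV. a j * \<xi> $ j)\<^sup>2)) \<le> 2 * exp (- L)"
proof -
  let ?y = "\<lambda>\<xi> :: real ^ 'd. \<Sum>j\<in>UNIV. a j * \<xi> $ j"
  \<comment> \<open>The optimal Chernoff parameter: at the threshold s |y| equals 2L, while the
    exponential moment costs only exp(L).\<close>
  define s where "s = sqrt (2 * L / \<sigma>)"
  have s: "0 \<le> s" "s\<^sup>2 * \<sigma> = 2 * L" using \<sigma> L by (auto simp: s_def)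
  have half: "avg sign_vectors (\<lambda>\<xi>. exp (c * ?y \<xi>)) \<le> exp L" if "c\<^sup>2 = s\<^sup>2" for c
  proof -
    have "avg sign_vectors (\<lambda>\<xi>. exp (c * ?y \<xi>)) \<le> exp ((\<Sum>j\<in>UNIV. (c * a j)\<^sup>2) / 2)"
      using rademacher_sum_exp_le [of UNIV "\<lambda>j. c * a j"] by (simp add: sum_distrib_left mult.assoc)
    also have "(\<Sum>j\<in>UNIV. (c * a j)\<^sup>2) = s\<^sup>2 * (\<Sum>j\<in>UNIV. (a j)\<^sup>2)"
      by (simp add: power_mult_distrib that sum_distrib_left)
    also have "\<dots> \<le> s\<^sup>2 * \<sigma>" using \<sigma> by (intro mult_left_mono) auto
    finally show ?thesis using s by (simp add: divide_right_mono)
  qed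
  have "avg sign_vectors (\<lambda>\<xi>. of_bool (2 * \<sigma> * L < (?y \<xi>)\<^sup>2))
    \<le> avg sign_vectors (\<lambda>\<xi>. exp (- (2 * L)) * exp (s * ?y \<xi>) + exp (- (2 * L)) * exp ((- s) * ?y \<xi>))"
  proof (rule avg_mono)
    fix \<xi>
    show "of_bool (2 * \<sigma> * L < (?y \<xi>)\<^sup>2)
      \<le> exp (- (2 * L)) * exp (s * ?y \<xi>) + exp (- (2 * L)) * exp ((- s) * ?y \<xi>)"
    proof (cases "2 * \<sigma> * L < (?y \<xi>)\<^sup>2")
      case True
      have "(2 * L)\<^sup>2 = s\<^sup>2 * (2 * \<sigma> * L)"
        using s by (simp add: power2_eq_square mult_ac)
      also have "\<dots> \<le> s\<^sup>2 * (?y \<xi>)\<^sup>2" using True by (intro mult_left_mono) auto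
      finally have "(2 * L)\<^sup>2 \<le> (s * \<bar>?y \<xi>\<bar>)\<^sup>2" by (simp add: power_mult_distrib)
      then have "2 * L \<le> s * \<bar>?y \<xi>\<bar>" by (rule power2_le_imp_le) (use s in simp)
      then have "2 * L \<le> s * ?y \<xi> \<or> 2 * L \<le> - s * ?y \<xi>" by (auto simp: abs_if split: if_splits)
      then have "1 \<le> exp (- (2 * L) + s * ?y \<xi>) \<or> 1 \<le> exp (- (2 * L) + (- s) * ?y \<xi>)"
        by auto
      then show ?thesis
        using True unfolding exp_add [symmetric]
        by (smt (verit) exp_gt_zero of_bool_eq(2))
    qed simp
  qed
  also have "\<dots> \<le> exp (- (2 * L)) * exp L + exp (- (2 * L)) * exp L"
    unfolding avg_add avg_cmult using half [of s] half [of "- s"]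
    by (intro add_mono mult_left_mono) auto
  also have "\<dots> = 2 * exp (- L)" by (simp add: exp_add [symmetric])
  finally show ?thesis .
qed

lemma avg_permutation_trace_tail_le:
  fixes c u :: "'d::finite \<Rightarrow> real"
  assumes c: "\<And>k. 0 \<le> c k" "avg UNIV c = 1"
    and u: "\<And>j. 0 \<le> u j" "(\<Sum>j\<in>UNIV. u j) = 1"
    and R: "\<And>j k. u j * c k \<le> 1 / (18 * m * l)" and m: "1 \<le> m" and l: "0 < l"
  shows "avg {\<pi>. \<pi> permutes UNIV}
      (\<lambda>\<pi>. of_bool (\<not> \<bar>(\<Sum>k\<in>UNIV. u (\<pi> k) * c k) - 1\<bar> \<le> 1 / (2 * sqrt m))) \<le> 2 * exp (- l)"
proof -
  let ?P = "{\<pi> :: 'd \<Rightarrow> 'd. \<pi> permutes UNIV}"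
  let ?F = "\<lambda>\<pi>. \<Sum>k\<in>UNIV. u (\<pi> k) * c k"
  define \<delta> where "\<delta> = 1 / (4 * sqrt m)"
  \<comment> \<open>The choice \<theta> R = \<delta> makes the variance cost \<theta>^2 R = \<theta>
    \<delta> half of the gain 2 \<delta> \<theta>. What remains is 18 m l \<delta>^2 = (18/16)
    l.\<close>
  define \<theta> where "\<theta> = 18 * m * l * \<delta>"
  define R where "R = 1 / (18 * m * l)"
  have "1 \<le> 4 * sqrt m" using real_sqrt_ge_one [OF m] by linarith
  then have \<delta>: "0 < \<delta>" "\<delta> \<le> 1" "1 / (2 * sqrt m) = 2 * \<delta>" "16 * m * \<delta>\<^sup>2 = 1"
    using m by (auto simp: \<delta>_def power2_eq_square divide_simps)
  have \<theta>: "0 \<le> \<theta>" "\<theta> * R = \<delta>" using m l \<delta> by (auto simp: \<theta>_def R_def)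
  have \<theta>\<delta>: "l \<le> \<theta> * \<delta>"
  proof -
    have "\<theta> * \<delta> = (18 / 16) * l * (16 * m * \<delta>\<^sup>2)" by (simp add: \<theta>_def power2_eq_square)
    then show ?thesis using \<delta> l by simp
  qed
  have mgf: "avg ?P (\<lambda>\<pi>. exp (t * ?F \<pi>)) \<le> exp (t + \<theta> * \<delta>)" if "\<bar>t\<bar> = \<theta>" for t
  proof -
    have "t\<^sup>2 = \<theta>\<^sup>2" using that by (metis power2_abs)
    then have "t\<^sup>2 * R = \<theta> * \<delta>" using \<theta> by (simp add: power2_eq_square mult.assoc)
    moreover have "avg ?P (\<lambda>\<pi>. exp (t * ?F \<pi>)) \<le> exp (t + t\<^sup>2 * R)"
      using assms that \<theta> \<delta> by (intro avg_permutation_exp_le) (auto simp: R_def)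
    ultimately show ?thesis by simp
  qed
  have one: "avg ?P (\<lambda>\<pi>. of_bool (2 * \<delta> * \<theta> < t * (?F \<pi> - 1))) \<le> exp (- l)" if t: "\<bar>t\<bar> = \<theta>" for t
  proof -
    have "avg ?P (\<lambda>\<pi>. of_bool (2 * \<delta> * \<theta> < t * (?F \<pi> - 1)))
      \<le> avg ?P (\<lambda>\<pi>. exp (- t - 2 * \<delta> * \<theta>) * exp (t * ?F \<pi>))"
      unfolding exp_add [symmetric] by (intro avg_mono of_bool_le_exp) (simp add: algebra_simps)
    also have "\<dots> \<le> exp (- t - 2 * \<delta> * \<theta>) * exp (t + \<theta> * \<delta>)"
      unfolding avg_cmult using mgf [OF t] by (intro mult_left_mono) auto
    also have "\<dots> \<le> exp (- l)"
      unfolding exp_add [symmetric] exp_le_cancel_iff using \<theta>\<delta> by (simp add: mult_ac)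
    finally show ?thesis .
  qed
  have pos: "0 < \<theta>" using m l \<delta> by (simp add: \<theta>_def)
  have "avg ?P (\<lambda>\<pi>. of_bool (\<not> \<bar>?F \<pi> - 1\<bar> \<le> 1 / (2 * sqrt m)))
    \<le> avg ?P (\<lambda>\<pi>. of_bool (2 * \<delta> * \<theta> < \<theta> * (?F \<pi> - 1)) + of_bool (2 * \<delta> * \<theta> < (- \<theta>) * (?F \<pi> - 1)))"
  proof (rule avg_mono)
    fix \<pi>
    have "2 * \<delta> * \<theta> < \<theta> * (?F \<pi> - 1) \<or> 2 * \<delta> * \<theta> < (- \<theta>) * (?F \<pi> - 1)"
      if "\<not> \<bar>?F \<pi> - 1\<bar> \<le> 1 / (2 * sqrt m)"
    proof -
      have "2 * \<delta> < \<bar>?F \<pi> - 1\<bar>" using that \<delta> by simp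
      then have "\<theta> * (2 * \<delta>) < \<theta> * \<bar>?F \<pi> - 1\<bar>" using pos by (rule mult_strict_left_mono)
      then show ?thesis by (cases "0 \<le> ?F \<pi> - 1") (auto simp: algebra_simps)
    qed
    then show "of_bool (\<not> \<bar>?F \<pi> - 1\<bar> \<le> 1 / (2 * sqrt m))
      \<le> of_bool (2 * \<delta> * \<theta> < \<theta> * (?F \<pi> - 1)) + (of_bool (2 * \<delta> * \<theta> < (- \<theta>) * (?F \<pi> - 1)) :: real)"
      by (smt (verit) of_bool_eq zero_less_one)
  qed
  also have "\<dots> \<le> 2 * exp (- l)"
    unfolding avg_add using one [of \<theta>] one [of "- \<theta>"] \<theta> by simp
  finally show ?thesis .
qed

text \<open>Two levels are kept apart: the eigenvalue event carries the factor m and is run at L,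
  the trace and the chaos at the smaller l. A permutation with a bad eigenvalue or trace is charged
  the full mass 1.\<close>

lemma permuted_chaos_tail_le:
  fixes h :: "'d::finite \<Rightarrow> real ^ 'n::finite" and y :: "'d \<Rightarrow> real" and l L :: real
  defines "m \<equiv> real CARD('n)"
  assumes iso: "(\<Sum>k\<in>UNIV. outer (h k)) = (real CARD('d) / m) *\<^sub>R mat 1"
    and y: "(\<Sum>j\<in>UNIV. (y j)\<^sup>2) = 1" and R: "\<And>j k. (y j)\<^sup>2 * (h k \<bullet> h k) \<le> 1 / (18 * m * L)"
    and l: "1 \<le> l" "l \<le> L"
  shows "avg {\<pi>. \<pi> permutes UNIV} (\<lambda>\<pi>. avg sign_vectors
      (\<lambda>\<xi>. of_bool (\<not> \<bar>norm (\<Sum>k\<in>UNIV. \<xi> $ k *\<^sub>R y (\<pi> k) *\<^sub>R h k) - 1\<bar> \<le> 10 * sqrt (l / m))))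
    \<le> m * exp (- L) + 4 * exp (- l)"
proof -
  let ?P = "{\<pi> :: 'd \<Rightarrow> 'd. \<pi> permutes UNIV}"
  let ?S = "\<lambda>\<pi>. \<Sum>k\<in>UNIV. (y (\<pi> k))\<^sup>2 *\<^sub>R outer (h k)"
  let ?F = "\<lambda>\<pi>. \<Sum>k\<in>UNIV. (y (\<pi> k))\<^sup>2 * (h k \<bullet> h k)"
  let ?op = "\<lambda>\<pi>. \<exists>x. norm x = 1 \<and> 2 / m \<le> x \<bullet> (?S \<pi> *v x)"
  let ?tr = "\<lambda>\<pi>. \<not> \<bar>?F \<pi> - 1\<bar> \<le> 1 / (2 * sqrt m)"
  have m: "1 \<le> m" by (simp add: m_def Suc_leI)
  have L: "1 \<le> L" using l by simp
  have op_le: "avg ?P (\<lambda>\<pi>. of_bool (?op \<pi>)) \<le> m * exp (- L)"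
  proof -
    \<comment> \<open>Then \<theta> R = 1/6 and exp(1/6) \<le> 6/5, so the exponent is at most
      (18/5) L - 6 L, below -L.\<close>
    define \<theta> where "\<theta> = 3 * m * L"
    have "\<theta> * (1 / (18 * m * L)) = 1 / 6" using m L by (simp add: \<theta>_def)
    then have "exp (\<theta> * (1 / (18 * m * L))) = exp (1 / 6)" by (rule arg_cong)
    moreover have "exp (1 / 6) \<le> (6 / 5 :: real)"
      using exp_bound [of "1 / 6"] by (simp add: power2_eq_square)
    ultimately have e: "exp (\<theta> * (1 / (18 * m * L))) \<le> 6 / 5" by linarith
    have "avg ?P (\<lambda>\<pi>. of_bool (?op \<pi>))
      \<le> m * exp (1 / m * \<theta> * exp (\<theta> * (1 / (18 * m * L))) - \<theta> * (2 / m))"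
      unfolding m_def
      by (rule avg_permutation_quad_tail_le)
        (use iso y R m L in \<open>auto simp: m_def [symmetric] \<theta>_def\<close>)
    also have "\<dots> \<le> m * exp (- L)"
    proof -
      have "1 / m * \<theta> * exp (\<theta> * (1 / (18 * m * L))) \<le> 1 / m * \<theta> * (6 / 5)"
        using e m L by (intro mult_left_mono) (auto simp: \<theta>_def)
      also have "1 / m * \<theta> * (6 / 5) - \<theta> * (2 / m) \<le> - L"
        using m L by (simp add: \<theta>_def)
      finally show ?thesis using m by (intro mult_left_mono) auto
    qed
    finally show ?thesis .
  qed
  have tr_le: "avg ?P (\<lambda>\<pi>. of_bool (?tr \<pi>)) \<le> 2 * exp (- l)"
  proof (rule avg_permutation_trace_tail_le)
    have "(\<Sum>k\<in>UNIV. h k \<bullet> h k) = trace (\<Sum>k\<in>UNIV. outer (h k))"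
      using sum_quad_eq_trace [of h "mat 1" UNIV] by simp
    also have "\<dots> = real CARD('d)"
      unfolding iso using m by (simp add: trace_scaleR trace_I m_def)
    finally show "avg UNIV (\<lambda>k. h k \<bullet> h k) = 1" by (simp add: avg_def)
    have "1 / (18 * m * L) \<le> 1 / (18 * m * l)"
      using m l by (intro divide_left_mono) auto
    then show "(y j)\<^sup>2 * (h k \<bullet> h k) \<le> 1 / (18 * m * l)" for j k
      using R [of j k] by linarith
  qed (use y m l in auto)
  have "avg ?P (\<lambda>\<pi>. avg sign_vectors
      (\<lambda>\<xi>. of_bool (\<not> \<bar>norm (\<Sum>k\<in>UNIV. \<xi> $ k *\<^sub>R y (\<pi> k) *\<^sub>R h k) - 1\<bar> \<le> 10 * sqrt (l / m))))
    \<le> avg ?P (\<lambda>\<pi>. of_bool (?op \<pi>) + of_bool (?tr \<pi>) + 2 * exp (- l))"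
  proof (rule avg_mono)
    fix \<pi>
    let ?a = "avg sign_vectors
      (\<lambda>\<xi>. of_bool (\<not> \<bar>norm (\<Sum>k\<in>UNIV. \<xi> $ k *\<^sub>R y (\<pi> k) *\<^sub>R h k) - 1\<bar> \<le> 10 * sqrt (l / m)))"
    have "?a \<le> avg (sign_vectors :: (real ^ 'd) set) (\<lambda>_. 1)" by (intro avg_mono) auto
    then have a1: "?a \<le> 1" by (simp add: avg_signs_const)
    have a2: "?a \<le> 2 * exp (- l)" if "\<not> ?op \<pi>" "\<not> ?tr \<pi>"
    proof (rule rademacher_vector_norm_tail_le)
      have quad: "(\<Sum>k\<in>UNIV. (x \<bullet> (y (\<pi> k) *\<^sub>R h k))\<^sup>2) = x \<bullet> (?S \<pi> *v x)" for x
      proof -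
        have "?S \<pi> *v x = (\<Sum>k\<in>UNIV. ((y (\<pi> k))\<^sup>2 *\<^sub>R outer (h k)) *v x)"
          by (induction rule: infinite_finite_induct [of _ UNIV])
            (auto simp: matrix_vector_mult_add_rdistrib)
        then show ?thesis
          by (simp add: inner_sum_right matrix_scaleR_vector outer_mult_vec power2_eq_square
              inner_commute mult_ac)
      qed
      show "(\<Sum>k\<in>UNIV. (x \<bullet> (y (\<pi> k) *\<^sub>R h k))\<^sup>2) \<le> 2 / m * (x \<bullet> x)" for x
      proof (cases "x = 0")
        case False
        \<comment> \<open>The eigenvalue event speaks of unit vectors; homogeneity extends the bound
          to all x.\<close>
        define e where "e = x /\<^sub>R norm x"
        have x: "x = norm x *\<^sub>R e" and e: "norm e = 1" using False by (auto simp: e_def)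
        have "e \<bullet> (?S \<pi> *v e) \<le> 2 / m" using that(1) e by (meson linear)
        then have "(norm x)\<^sup>2 * (e \<bullet> (?S \<pi> *v e)) \<le> (norm x)\<^sup>2 * (2 / m)"
          by (intro mult_left_mono) auto
        also have "(norm x)\<^sup>2 * (e \<bullet> (?S \<pi> *v e)) = (norm x *\<^sub>R e) \<bullet> (?S \<pi> *v (norm x *\<^sub>R e))"
          by (simp add: matrix_vector_scaleR power2_eq_square)
        also have "\<dots> = x \<bullet> (?S \<pi> *v x)"
          by (simp only: x [symmetric])
        finally show ?thesis unfolding quad by (simp add: power2_norm_eq_inner mult.commute)
      qed simp
      have "?F \<pi> = (\<Sum>k\<in>UNIV. (y (\<pi> k) *\<^sub>R h k) \<bullet> (y (\<pi> k) *\<^sub>R h k))"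
        by (simp add: power2_eq_square mult.assoc)
      with that(2) show "\<bar>(\<Sum>k\<in>UNIV. (y (\<pi> k) *\<^sub>R h k) \<bullet> (y (\<pi> k) *\<^sub>R h k)) - 1\<bar> \<le> 1 / (2 * sqrt m)"
        by simp
    qed (use m l in auto)
    show "?a \<le> of_bool (?op \<pi>) + of_bool (?tr \<pi>) + 2 * exp (- l)"
    proof (cases "?op \<pi> \<or> ?tr \<pi>")
      case True
      then have "(1 :: real) \<le> of_bool (?op \<pi>) + of_bool (?tr \<pi>)"
        by (elim disjE) (simp_all only: of_bool_eq, simp_all)
      then show ?thesis using a1 exp_ge_zero [of "- l"] by linarith
    next
      case False
      then have "?a \<le> 2 * exp (- l)" by (intro a2) auto
      moreover have "(0 :: real) \<le> of_bool (?op \<pi>)" "(0 :: real) \<le> of_bool (?tr \<pi>)" by simp_all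
      ultimately show ?thesis by linarith
    qed
  qed
  also have "\<dots> \<le> m * exp (- L) + 4 * exp (- l)"
    unfolding avg_add avg_permutations_const using op_le tr_le by linarith
  finally show ?thesis .
qed

section \<open>The random map\<close>

lemma pair_pmf_of_set:
  assumes "finite S" "S \<noteq> {}" "finite T" "T \<noteq> {}"
  shows "pair_pmf (pmf_of_set S) (pmf_of_set T) = pmf_of_set (S \<times> T)"
proof (rule pmf_eqI)
  fix z :: "'a \<times> 'b"
  show "pmf (pair_pmf (pmf_of_set S) (pmf_of_set T)) z = pmf (pmf_of_set (S \<times> T)) z"
    using assms by (cases z) (auto simp: pmf_pair pmf_of_set card_cartesian_product indicator_def)
qed

lemma prob_pmf_of_set_eq_avg:
  assumes "finite S" "S \<noteq> {}"
  shows "measure_pmf.prob (pmf_of_set S) E = avg S (\<lambda>s. of_bool (s \<in> E))"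
proof -
  have "(\<Sum>s\<in>S. of_bool (s \<in> E)) = real (card (S \<inter> E))"
    using assms by (simp add: sum.If_cases of_bool_def Int_def)
  then show ?thesis using assms by (simp add: measure_pmf_of_set avg_def)
qed

text \<open>The order of the averages follows the conditioning: \<xi>' fixes y, then \<pi> fixes S,
  and \<xi> is averaged innermost.\<close>

lemma prob_random_source:
  fixes E :: "((real ^ 'd::finite) \<times> (real ^ 'd) \<times> ('d \<Rightarrow> 'd)) set"
  shows "measure_pmf.prob random_source E = avg sign_vectors (\<lambda>\<xi>'. avg {\<pi>. \<pi> permutes UNIV}
      (\<lambda>\<pi>. avg sign_vectors (\<lambda>\<xi>. of_bool ((\<xi>, \<xi>', \<pi>) \<in> E))))"
proof -
  let ?S = "sign_vectors :: (real ^ 'd) set"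
  let ?P = "{\<pi> :: 'd \<Rightarrow> 'd. \<pi> permutes UNIV}"
  have "measure_pmf.prob random_source E = avg (?S \<times> ?S \<times> ?P) (\<lambda>s. of_bool (s \<in> E))"
    unfolding random_source_def
    using sign_vectors_finite_nonempty [where 'd = 'd] permutations_finite_nonempty [where 'd = 'd]
    by (simp add: pair_pmf_of_set prob_pmf_of_set_eq_avg del: finite_permutations)
  also have "\<dots> = avg ?S (\<lambda>\<xi>. avg ?S (\<lambda>\<xi>'. avg ?P (\<lambda>\<pi>. of_bool ((\<xi>, \<xi>', \<pi>) \<in> E))))"
    by (simp only: avg_Times)
  also have "\<dots> = avg ?S (\<lambda>\<xi>'. avg ?S (\<lambda>\<xi>. avg ?P (\<lambda>\<pi>. of_bool ((\<xi>, \<xi>', \<pi>) \<in> E))))"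
    by (rule avg_swap)
  also have "\<dots> = avg ?S (\<lambda>\<xi>'. avg ?P (\<lambda>\<pi>. avg ?S (\<lambda>\<xi>. of_bool ((\<xi>, \<xi>', \<pi>) \<in> E))))"
    by (intro avg_cong avg_swap)
  finally show ?thesis .
qed

section \<open>Sampled columns, variance and orthogonality\<close>

lemma diag_matrix_mult_vec: "(diag_matrix v *v x) $ k = v $ k * x $ k"
  by (simp add: diag_matrix_def matrix_vector_mult_def if_distrib [of "\<lambda>c. c * _"] cong: if_cong)

definition sampled_column :: "('m \<Rightarrow> 'd) \<Rightarrow> real ^ 'd ^ 'd \<Rightarrow> 'd \<Rightarrow> real ^ 'm::finite" where
  "sampled_column e A k = (\<chi> i. sqrt (real CARD('d::finite) / real CARD('m)) * A $ e i $ k)"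

lemma random_map_mult_vec:
  "random_map e A B \<xi> \<xi>' \<pi> *v x
    = (\<Sum>k\<in>UNIV. \<xi> $ k *\<^sub>R (B *v (diag_matrix \<xi>' *v x)) $ \<pi> k *\<^sub>R sampled_column e A k)"
proof -
  let ?w = "diag_matrix \<xi> *v (reindex_matrix \<pi> *v (B *v (diag_matrix \<xi>' *v x)))"
  have "random_map e A B \<xi> \<xi>' \<pi> *v x
     = sqrt (real CARD('b) / real CARD('a)) *\<^sub>R (reindex_matrix e *v (A *v ?w))"
    by (simp add: random_map_def matrix_scaleR_vector matrix_vector_mul_assoc matrix_mul_assoc)
  then show ?thesis
    by (simp add: vec_eq_iff reindex_matrix_mult_vec sampled_column_def diag_matrix_mult_vec
        matrix_vector_mult_def [of A] sum_distrib_left mult_ac)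
qed

text \<open>The isotropy behind the matrix Chernoff bound: rows of A are orthonormal, and
  injectivity of e keeps the selected rows distinct.\<close>

lemma sum_outer_sampled_column:
  fixes A :: "real ^ 'd::finite ^ 'd" and e :: "'m::finite \<Rightarrow> 'd"
  assumes "orthogonal_matrix A" "inj e"
  shows "(\<Sum>k\<in>UNIV. outer (sampled_column e A k)) = (real CARD('d) / real CARD('m)) *\<^sub>R mat 1"
proof -
  have "A ** transpose A = mat 1" using assms by (simp add: orthogonal_matrix_def)
  then have row: "(\<Sum>k\<in>UNIV. A $ i $ k * A $ j $ k) = of_bool (i = j)" for i j
    by (auto simp: vec_eq_iff matrix_matrix_mult_def transpose_def mat_def split: if_splits)
  have "(\<Sum>k\<in>UNIV. outer (sampled_column e A k)) $ i $ j
      = (real CARD('d) / real CARD('m)) * (\<Sum>k\<in>UNIV. A $ e i $ k * A $ e j $ k)" for i j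
    by (simp add: outer_def sampled_column_def sum_distrib_left mult_ac)
  then show ?thesis
    using assms by (simp add: vec_eq_iff row mat_def inj_eq)
qed

lemma sampled_column_inner_le:
  fixes A :: "real ^ 'd::finite ^ 'd" and e :: "'m::finite \<Rightarrow> 'd"
  assumes "bij_betw e UNIV I"
  shows "sampled_column e A k \<bullet> sampled_column e A k \<le> column_energy I A"
proof -
  have card: "card I = CARD('m)" using assms by (simp add: bij_betw_same_card)
  have "sampled_column e A k \<bullet> sampled_column e A k
      = real CARD('d) / real CARD('m) * (\<Sum>i\<in>UNIV. (A $ e i $ k)\<^sup>2)"
    by (simp add: sampled_column_def inner_vec_def sum_distrib_left power2_eq_square mult_ac)
  also have "(\<Sum>i\<in>UNIV. (A $ e i $ k)\<^sup>2) = (\<Sum>j\<in>I. (A $ j $ k)\<^sup>2)"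
    by (rule sum.reindex_bij_betw [OF assms])
  also have "real CARD('d) / real CARD('m) * \<dots>
      \<le> real CARD('d) / real CARD('m) * (MAX k. \<Sum>j\<in>I. (A $ j $ k)\<^sup>2)"
    by (intro mult_left_mono Max_ge) auto
  finally show ?thesis by (simp add: column_energy_def card)
qed

lemma variance_le_max_variance:
  fixes B :: "real ^ 'd::finite ^ 'd"
  assumes "finite X" "x \<in> X"
  shows "(\<Sum>j\<in>UNIV. (B $ k $ j * x $ j)\<^sup>2) \<le> max_variance B X / real CARD('d)"
proof -
  let ?f = "\<lambda>(x :: real ^ 'd, k). \<Sum>j\<in>UNIV. (B $ k $ j)\<^sup>2 * (x $ j)\<^sup>2"
  have "?f (x, k) \<le> (SUP z \<in> X \<times> UNIV. ?f z)"
    using assms by (intro cSUP_upper bdd_above_finite finite_imageI) auto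
  then show ?thesis by (simp add: max_variance_def power_mult_distrib)
qed

lemma norm_orthogonal_matrix_mult:
  fixes B :: "real ^ 'd::finite ^ 'd"
  assumes "orthogonal_matrix B"
  shows "norm (B *v x) = norm x"
  using assms orthogonal_transformation_matrix [of "(*v) B"]
  by (simp add: orthogonal_transformation_norm)

lemma norm_diag_sign:
  assumes "\<xi> \<in> sign_vectors"
  shows "norm (diag_matrix \<xi> *v x) = norm x"
  by (simp add: norm_eq_sqrt_inner inner_vec_def diag_matrix_mult_vec power2_eq_square [symmetric]
      power_mult_distrib sign_vectors_square [OF assms])

text \<open>The Chernoff parameter for the coordinates of y divides by the variance bound, which
  must therefore be positive. Variance zero would give B x = 0, although B preserves the norm of
  x.\<close>

lemma max_variance_pos:
  fixes B :: "real ^ 'd::finite ^ 'd"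
  assumes "finite X" "x \<in> X" "norm x = 1" "orthogonal_matrix B"
  shows "0 < max_variance B X"
proof (rule ccontr)
  assume "\<not> 0 < max_variance B X"
  then have "max_variance B X / real CARD('d) \<le> 0" by (simp add: divide_nonpos_nonneg)
  then have z: "(\<Sum>j\<in>UNIV. (B $ k $ j * x $ j)\<^sup>2) \<le> 0" for k
    using variance_le_max_variance [OF assms(1,2), of B k] by linarith
  have "B $ k $ j * x $ j = 0" for k j
    using z [of k] sum_nonneg_eq_0_iff [of UNIV "\<lambda>j. (B $ k $ j * x $ j)\<^sup>2"]
    by (simp add: order_antisym_conv sum_nonneg)
  then have "B *v x = 0"
    by (simp only: vec_eq_iff matrix_vector_mult_def vec_lambda_beta sum.neutral_const zero_index simp_thms)
  then show False using norm_orthogonal_matrix_mult [OF assms(4), of x] assms(3) by simp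
qed

text \<open>Flatness of y depends on \<xi>' alone. A non-flat \<xi>' is charged the full mass 1, at
  total cost 2 d exp(-L_d); for a flat one the energy condition supplies the hypothesis of the
  permuted chaos bound.\<close>

lemma random_map_norm_tail_le:
  fixes A B :: "real ^ 'd::finite ^ 'd" and e :: "'m::finite \<Rightarrow> 'd" and l L_d L_m :: real
  defines "d \<equiv> real CARD('d)" and "m \<equiv> real CARD('m)"
  assumes A: "orthogonal_matrix A" and B: "orthogonal_matrix B" and e: "bij_betw e UNIV I"
    and X: "finite X" "x \<in> X" "norm x = 1" and l: "1 \<le> l" "l \<le> L_m" and L: "0 \<le> L_d"
    and cond: "36 * column_energy I A * max_variance B X * m * L_d * L_m \<le> d"
  shows "avg sign_vectors (\<lambda>\<xi>'. avg {\<pi>. \<pi> permutes UNIV} (\<lambda>\<pi>. avg sign_vectors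
      (\<lambda>\<xi>. of_bool (\<not> \<bar>norm (random_map e A B \<xi> \<xi>' \<pi> *v x) - 1\<bar> \<le> 10 * sqrt (l / m)))))
    \<le> 2 * d * exp (- L_d) + m * exp (- L_m) + 4 * exp (- l)"
proof -
  let ?P = "{\<pi> :: 'd \<Rightarrow> 'd. \<pi> permutes UNIV}"
  let ?y = "\<lambda>\<xi>' k. (B *v (diag_matrix \<xi>' *v x)) $ k"
  define \<sigma> where "\<sigma> = max_variance B X / d"
  define bad where "bad \<xi>' = avg ?P (\<lambda>\<pi>. avg sign_vectors
      (\<lambda>\<xi>. of_bool (\<not> \<bar>norm (random_map e A B \<xi> \<xi>' \<pi> *v x) - 1\<bar> \<le> 10 * sqrt (l / m))))" for \<xi>'
  have d: "0 < d" and m: "0 < m" by (auto simp: d_def m_def)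
  have \<sigma>: "0 < \<sigma>" using max_variance_pos [OF X B] d by (simp add: \<sigma>_def)
  \<comment> \<open>The assumed condition rearranged: 36 = 2 * 18, the 2 from the flatness threshold
    and the 18 from the permutation bounds.\<close>
  have U: "2 * \<sigma> * L_d * column_energy I A \<le> 1 / (18 * m * L_m)"
    using cond d m l by (simp add: \<sigma>_def field_simps)
  have bad_le: "bad \<xi>' \<le> m * exp (- L_m) + 4 * exp (- l)"
    if \<xi>': "\<xi>' \<in> sign_vectors" and flat: "\<And>k. (?y \<xi>' k)\<^sup>2 \<le> 2 * \<sigma> * L_d" for \<xi>'
    unfolding bad_def random_map_mult_vec m_def
  proof (rule permuted_chaos_tail_le)
    show "(\<Sum>k\<in>UNIV. outer (sampled_column e A k)) = (real CARD('d) / real CARD('m)) *\<^sub>R mat 1"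
      using e by (intro sum_outer_sampled_column A) (simp add: bij_betw_def)
    have "(\<Sum>j\<in>UNIV. (?y \<xi>' j)\<^sup>2) = (norm (B *v (diag_matrix \<xi>' *v x)))\<^sup>2"
      by (subst power2_norm_eq_inner) (simp add: inner_vec_def power2_eq_square)
    then show "(\<Sum>j\<in>UNIV. (?y \<xi>' j)\<^sup>2) = 1"
      using X by (simp add: norm_orthogonal_matrix_mult [OF B] norm_diag_sign [OF \<xi>'])
    show "(?y \<xi>' j)\<^sup>2 * (sampled_column e A k \<bullet> sampled_column e A k) \<le> 1 / (18 * real CARD('m) * L_m)"
      for j k
    proof -
      have "(?y \<xi>' j)\<^sup>2 * (sampled_column e A k \<bullet> sampled_column e A k)
        \<le> (2 * \<sigma> * L_d) * column_energy I A"
        using flat \<sigma> L by (intro mult_mono sampled_column_inner_le e) auto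
      then show ?thesis using U by (simp add: m_def)
    qed
  qed (use l in auto)
  have flat_tail: "avg sign_vectors (\<lambda>\<xi>'. of_bool (2 * \<sigma> * L_d < (?y \<xi>' k)\<^sup>2)) \<le> 2 * exp (- L_d)" for k
  proof -
    have "?y \<xi>' k = (\<Sum>j\<in>UNIV. (B $ k $ j * x $ j) * \<xi>' $ j)" for \<xi>'
      by (simp add: matrix_vector_mult_def [of B] diag_matrix_mult_vec mult_ac)
    then show ?thesis
      using rademacher_sum_tail_le [OF _ \<sigma> L, of "\<lambda>j. B $ k $ j * x $ j"]
        variance_le_max_variance [OF X(1,2), of B k] by (simp add: \<sigma>_def d_def)
  qed
  \<comment> \<open>The union bound over coordinates is written as a sum of indicators, which can be
    averaged term by term.\<close>
  have "avg sign_vectors bad \<le> avg sign_vectors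
      (\<lambda>\<xi>'. (\<Sum>k\<in>UNIV. of_bool (2 * \<sigma> * L_d < (?y \<xi>' k)\<^sup>2)) + (m * exp (- L_m) + 4 * exp (- l)))"
  proof (rule avg_mono)
    fix \<xi>' :: "real ^ 'd" assume \<xi>': "\<xi>' \<in> sign_vectors"
    have nonneg: "0 \<le> m * exp (- L_m) + 4 * exp (- l)" using m by simp
    show "bad \<xi>' \<le> (\<Sum>k\<in>UNIV. of_bool (2 * \<sigma> * L_d < (?y \<xi>' k)\<^sup>2)) + (m * exp (- L_m) + 4 * exp (- l))"
    proof (cases "\<exists>k. 2 * \<sigma> * L_d < (?y \<xi>' k)\<^sup>2")
      case True
      then obtain k where k: "2 * \<sigma> * L_d < (?y \<xi>' k)\<^sup>2" by blast
      have "bad \<xi>' \<le> avg ?P (\<lambda>\<pi>. avg (sign_vectors :: (real ^ 'd) set) (\<lambda>\<xi>. 1))"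
        unfolding bad_def by (intro avg_mono) auto
      also have "\<dots> = 1"
        by (simp only: avg_signs_const avg_permutations_const)
      also have "\<dots> = of_bool (2 * \<sigma> * L_d < (?y \<xi>' k)\<^sup>2)" using k by simp
      also have "\<dots> \<le> (\<Sum>k\<in>UNIV. of_bool (2 * \<sigma> * L_d < (?y \<xi>' k)\<^sup>2))"
        by (rule member_le_sum) auto
      finally show ?thesis using nonneg by linarith
    next
      case False
      then have "bad \<xi>' \<le> m * exp (- L_m) + 4 * exp (- l)" by (intro bad_le \<xi>') (simp add: not_less)
      moreover have "0 \<le> (\<Sum>k\<in>UNIV. of_bool (2 * \<sigma> * L_d < (?y \<xi>' k)\<^sup>2) :: real)"
        by (intro sum_nonneg) simp
      ultimately show ?thesis by linarith
    qed
  qed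
  also have "\<dots> = (\<Sum>k\<in>UNIV. avg sign_vectors (\<lambda>\<xi>'. of_bool (2 * \<sigma> * L_d < (?y \<xi>' k)\<^sup>2)))
      + (m * exp (- L_m) + 4 * exp (- l))"
    unfolding avg_add avg_sum by (simp add: avg_signs_const)
  also have "(\<Sum>k\<in>UNIV. avg sign_vectors (\<lambda>\<xi>'. of_bool (2 * \<sigma> * L_d < (?y \<xi>' k)\<^sup>2)))
      \<le> (\<Sum>k\<in>(UNIV :: 'd set). 2 * exp (- L_d))"
    by (intro sum_mono flat_tail)
  finally show ?thesis by (simp add: bad_def [abs_def] d_def)
qed

theorem theorem1p5:
  fixes A B :: "real ^ 'd::finite ^ 'd"
    and I :: "'d set" and e :: "'m::finite \<Rightarrow> 'd"
    and X :: "(real ^ 'd) set"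
    and d m N :: nat and \<eta> l L_d L_m :: real
  assumes "d = CARD('d)"
    and "orthogonal_matrix A" and "orthogonal_matrix B"
    and "card I = m" and "1 \<le> m" and "m \<le> d"
    and "bij_betw e UNIV I"
    and "X \<subseteq> sphere 0 1" and "finite X" and "X \<noteq> {}" and "card X = N"
    and "0 < \<eta>" and "\<eta> < 1 / 2"
    and "l = ln (8 * real N / \<eta>)"
    and "L_d = ln (8 * real N * real d / \<eta>)"
    and "L_m = ln (8 * real N * real m / \<eta>)"
    and "36 * column_energy I A * max_variance B X * real m * L_d * L_m \<le> real d"
  shows "measure_pmf.prob random_source
           {(\<xi>, \<xi>', \<pi>). (SUP x\<in>X. \<bar>norm (random_map e A B \<xi> \<xi>' \<pi> *v x) - 1\<bar>) \<le> 10 * sqrt (l / real m)}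
         \<ge> 1 - \<eta>"
proof -
  note \<eta> = \<open>0 < \<eta>\<close> \<open>\<eta> < 1 / 2\<close>
  have m: "m = CARD('m)" using assms(4,7) bij_betw_same_card by metis
  have "0 < N" using assms(9,10) by (simp add: assms(11) [symmetric] card_gt_0_iff)
  then have N: "1 \<le> real N" by simp
  have d1: "1 \<le> real d" and m1: "1 \<le> real m" using assms by auto
  \<comment> \<open>From N \<ge> 1 and \<eta> < 1/2; since 16 exceeds e, this gives l \<ge> 1, which
    the norm concentration requires.\<close>
  have base: "16 \<le> 8 * real N / \<eta>"
    using N \<eta> by (simp add: field_simps)
  have "exp 1 \<le> 8 * real N / \<eta>" using base exp_le by linarith
  then have l1: "1 \<le> l" unfolding assms(14) using base by (subst ln_ge_iff) auto
  have lm: "l \<le> L_m" unfolding assms(14,16) using N m1 \<eta>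
    by (intro ln_mono) (auto simp: divide_right_mono)
  have ld: "l \<le> L_d" unfolding assms(14,15) using N d1 \<eta>
    by (intro ln_mono) (auto simp: divide_right_mono)
  \<comment> \<open>Each logarithm contains exactly the dimension factor of its failure term, so all
    three become the same share of \<eta>; summing over the N points cancels N.\<close>
  have e: "exp (- l) = \<eta> / (8 * real N)" "real d * exp (- L_d) = \<eta> / (8 * real N)"
      "real m * exp (- L_m) = \<eta> / (8 * real N)"
    using N d1 m1 \<eta> unfolding assms(14-16) by (auto simp: exp_minus field_simps)
  let ?S = "sign_vectors :: (real ^ 'd) set"
  let ?P = "{\<pi> :: 'd \<Rightarrow> 'd. \<pi> permutes UNIV}"
  let ?bad = "\<lambda>\<xi> \<xi>' \<pi> x. of_bool (\<not> \<bar>norm (random_map e A B \<xi> \<xi>' \<pi> *v x) - 1\<bar> \<le> 10 * sqrt (l / real m)) :: real"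
  let ?E = "{(\<xi>, \<xi>', \<pi>). (SUP x\<in>X. \<bar>norm (random_map e A B \<xi> \<xi>' \<pi> *v x) - 1\<bar>) \<le> 10 * sqrt (l / real m)}"
  let ?avg = "\<lambda>f. avg ?S (\<lambda>\<xi>'. avg ?P (\<lambda>\<pi>. avg ?S (\<lambda>\<xi>. f \<xi> \<xi>' \<pi> :: real)))"
  have "?avg (\<lambda>\<xi> \<xi>' \<pi>. \<Sum>x\<in>X. ?bad \<xi> \<xi>' \<pi> x) = (\<Sum>x\<in>X. ?avg (\<lambda>\<xi> \<xi>' \<pi>. ?bad \<xi> \<xi>' \<pi> x))"
    by (simp only: avg_sum)
  also have "\<dots> \<le> (\<Sum>x\<in>X. 2 * real d * exp (- L_d) + real m * exp (- L_m) + 4 * exp (- l))"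
  proof (intro sum_mono)
    fix x assume "x \<in> X"
    moreover have "norm x = 1" using \<open>x \<in> X\<close> assms(8) by auto
    ultimately show "?avg (\<lambda>\<xi> \<xi>' \<pi>. ?bad \<xi> \<xi>' \<pi> x)
      \<le> 2 * real d * exp (- L_d) + real m * exp (- L_m) + 4 * exp (- l)"
      unfolding m assms(1)
      using assms(7,9,17) l1 lm ld
      by (intro random_map_norm_tail_le assms(2,3,7,9)) (auto simp: m assms(1))
  qed
  also have "\<dots> = 7 * \<eta> / 8"
    using N assms(11) e by (simp add: field_simps)
  also have "\<dots> \<le> \<eta>" using \<eta> by simp
  finally have total: "?avg (\<lambda>\<xi> \<xi>' \<pi>. \<Sum>x\<in>X. ?bad \<xi> \<xi>' \<pi> x) \<le> \<eta>" .
  \<comment> \<open>Pointwise, the indicator of success is at least one minus the number of failing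
    points. Averaging this gives the union bound over X directly for the complement.\<close>
  have "1 - ?avg (\<lambda>\<xi> \<xi>' \<pi>. \<Sum>x\<in>X. ?bad \<xi> \<xi>' \<pi> x) = ?avg (\<lambda>\<xi> \<xi>' \<pi>. 1 + (- 1) * (\<Sum>x\<in>X. ?bad \<xi> \<xi>' \<pi> x))"
    unfolding avg_add avg_cmult avg_signs_const avg_permutations_const by simp
  also have "\<dots> \<le> ?avg (\<lambda>\<xi> \<xi>' \<pi>. of_bool ((\<xi>, \<xi>', \<pi>) \<in> ?E))"
  proof (intro avg_mono)
    fix \<xi> \<xi>' :: "real ^ 'd" and \<pi> :: "'d \<Rightarrow> 'd"
    have nonneg: "0 \<le> (\<Sum>x\<in>X. ?bad \<xi> \<xi>' \<pi> x)" by (intro sum_nonneg) simp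
    show "1 + (- 1) * (\<Sum>x\<in>X. ?bad \<xi> \<xi>' \<pi> x) \<le> of_bool ((\<xi>, \<xi>', \<pi>) \<in> ?E)"
    proof (cases "\<forall>x\<in>X. \<bar>norm (random_map e A B \<xi> \<xi>' \<pi> *v x) - 1\<bar> \<le> 10 * sqrt (l / real m)")
      case True
      then have "(\<xi>, \<xi>', \<pi>) \<in> ?E" using assms(10) by (auto intro!: cSUP_least)
      then have "of_bool ((\<xi>, \<xi>', \<pi>) \<in> ?E) = (1 :: real)" by (simp only: of_bool_eq)
      then show ?thesis using nonneg by linarith
    next
      case False
      then obtain x where x: "x \<in> X" "?bad \<xi> \<xi>' \<pi> x = 1" by auto
      have "?bad \<xi> \<xi>' \<pi> x \<le> (\<Sum>x\<in>X. ?bad \<xi> \<xi>' \<pi> x)"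
        using x assms(9) by (intro member_le_sum) auto
      moreover have "0 \<le> (of_bool ((\<xi>, \<xi>', \<pi>) \<in> ?E) :: real)" by simp
      ultimately show ?thesis using x by linarith
    qed
  qed
  also have "\<dots> = measure_pmf.prob random_source ?E"
    by (rule prob_random_source [symmetric])
  finally show ?thesis using total by linarith
qed

end
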